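(* Let $N\ge 1$, let $\omega_1,\dots,\omega_N\in\mathbb{R}$ and let $\kappa>0$ satisfy \[ \kappa>2\max_{i=1,\dots,N}|\omega_i|. \] For initial data $(\theta_1^0,\dots,\theta_N^0)\in\mathbb{R}^N$ let $(\theta_1(t),\dots,\theta_N(t))$ be the solution of \[ \dot\theta_i(t)=\omega_i-\frac{\kappa}{N}\sum_{j=1}^N\big(1+\cos\theta_j(t)\big)\sin\theta_i(t),\quad t>0,\qquad \theta_i(0)=\theta_i^0,\quad i=1,\dots,N, \] and let $R(t)=\frac1N\sum_{j=1}^N(1+\cos\theta_j(t))$. Then for Lebesgue almost every initial data $(\theta_i^0)_{i=1}^N\in\mathbb{R}^N$ the following hold: (a) for every $i=1,\dots,N$ the limit $\lim_{t\to\infty}\theta_i(t)$ exists and $\lim_{t\to\infty}\dot\theta_i(t)=0$; (b) the limit $R_\infty:=\lim_{t\to\infty}R(t)$ exists and \[ R_\infty\ge\sqrt{\frac12+\sqrt{\frac14-\frac{\max_i|\omega_i|^2}{\kappa^2}}}. \]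
   Context: The ODE is the (sinusoidal) Winfree model; $R$ is its order parameter. Solutions exist globally and are unique. *)

theory Defs
  imports "HOL-Analysis.Analysis"
begin

definition winfree_R :: "real ^ 'n \<Rightarrow> real" where
  "winfree_R \<theta> = (1 / real CARD('n)) * (\<Sum>j\<in>UNIV. 1 + cos (\<theta> $ j))"

definition winfree_field :: "real ^ 'n \<Rightarrow> real \<Rightarrow> real ^ 'n \<Rightarrow> real ^ 'n" where
  "winfree_field \<omega> \<kappa> \<theta> =
     (\<chi> i. \<omega> $ i - (\<kappa> / real CARD('n)) * (\<Sum>j\<in>UNIV. 1 + cos (\<theta> $ j)) * sin (\<theta> $ i))"

definition winfree_solution ::
  "real ^ 'n \<Rightarrow> real \<Rightarrow> real ^ 'n \<Rightarrow> (real \<Rightarrow> real ^ 'n) \<Rightarrow> bool" where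
  "winfree_solution \<omega> \<kappa> \<theta>0 \<theta> \<longleftrightarrow>
     \<theta> 0 = \<theta>0 \<and> continuous_on {0..} \<theta> \<and>
     (\<forall>t>0. (\<theta> has_vector_derivative winfree_field \<omega> \<kappa> (\<theta> t)) (at t))"

end

theory Submission
  imports Defs "HOL-Complex_Analysis.Conformal_Mappings" "HOL-Real_Asymp.Real_Asymp"
begin

text \<open>
  The divergence of the Winfree field is at least \<open>\<kappa> N R (1 - R)\<close>, so where \<open>R \<le> \<rho> < 1\<close> the flow expands volume
  exponentially in time (up to a bounded correction near \<open>R = 0\<close>), while bounded speed lets the volume of a moving ball grow only polynomially. Hence almost no
  trajectory keeps \<open>R \<le> \<rho>\<close> forever. Liouville's formula is used only for the Euler maps \<open>x \<mapsto> x + h F x\<close>, so neither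
  existence nor differentiability of the flow is needed.

  Once \<open>R\<close> is close to 1 it is trapped: while \<open>R \<ge> \<rho>\<close>, each \<open>cos \<theta>\<^sub>i\<close> is nondecreasing whenever \<open>|cos \<theta>\<^sub>i| \<le> c\<close>,
  \<open>c\<^sup>2 = 1 - max\<^sub>i \<omega>\<^sub>i\<^sup>2 / (\<kappa> \<rho>)\<^sup>2\<close>, hence drops by at most \<open>1 - c\<close>, and \<open>\<rho> < c\<close> for every \<open>\<rho>\<close> slightly below
  the claimed bound. Then all phases are bounded, the field is the gradient of
  \<open>\<Sum> \<omega>\<^sub>i \<theta>\<^sub>i + \<kappa> N R\<^sup>2 / 2\<close>, and so the velocities tend to 0. The limit points of \<open>R\<close> are zeros of
  a nonzero real-analytic function, hence \<open>R\<close> and then every phase converges.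
\<close>

text \<open>The constant in the bound comes from the requirement \<open>\<rho> < c\<close>. With m
  the largest frequency modulus it reads \<rho>^2 (1 - \<rho>^2) > m^2 / \<kappa>^2, and the larger
  root in \<rho>^2 is the square of the claimed bound; \<kappa> > 2 m puts this root strictly above
  1/2. The same inequality says that the level \<rho> + (1 - c), from which R can no longer fall to
  \<rho>, lies below 1. This is why volume expansion, which is guaranteed only while R stays below a
  number smaller than 1, suffices to carry almost every trajectory above it. Vanishing velocities
  alone do not give convergence: a trajectory could creep along a continuum of equilibria. R
  satisfies a scalar equation in the limit, but one that depends on which cosines are negative, and
  this set may change with time. Multiplying over all sign patterns removes the dependence; at r = 3
  no factor vanishes, so the product vanishes on no interval, and R eventually stays on one side of
  densely many levels.\<close>

section \<open>Volume growth under Euler steps\<close>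

text \<open>The library states the change of variables formula only for wellordered index types; \<open>widx\<close> provides one of
  the same cardinality as a given finite type, and null sets are transported by reindexing.\<close>

typedef 'n widx = "UNIV :: 'n set"
  morphisms of_widx to_widx ..

lemma bij_of_widx: "bij of_widx"
  by (metis UNIV_I bijI' of_widx_inject to_widx_inverse)

instance widx :: (finite) finite
proof
  show "finite (UNIV :: 'a widx set)"
    using bij_of_widx finite_class.finite_UNIV bij_betw_finite by blast
qed

instantiation widx :: (finite) wellorder
begin

definition "x \<le> y \<longleftrightarrow> to_nat_on (UNIV :: 'a set) (of_widx x) \<le> to_nat_on (UNIV :: 'a set) (of_widx y)"
definition "x < y \<longleftrightarrow> to_nat_on (UNIV :: 'a set) (of_widx x) < to_nat_on (UNIV :: 'a set) (of_widx y)"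

instance
proof
  have inj: "inj (\<lambda>x :: 'a widx. to_nat_on (UNIV :: 'a set) (of_widx x))"
    using inj_on_to_nat_on[of "UNIV :: 'a set"] by (auto simp: inj_on_def of_widx_inject)
  fix x y z :: "'a widx"
  show "(x < y) = (x \<le> y \<and> \<not> y \<le> x)" "x \<le> x" "x \<le> y \<or> y \<le> x"
    by (auto simp: less_eq_widx_def less_widx_def)
  show "x \<le> z" if "x \<le> y" "y \<le> z"
    using that by (auto simp: less_eq_widx_def)
  show "x = y" if "x \<le> y" "y \<le> x"
    using that inj by (auto simp: less_eq_widx_def inj_def)
  show "P a" if "\<And>x. (\<And>y. y < x \<Longrightarrow> P y) \<Longrightarrow> P x" for P and a :: "'a widx"
  proof (induction a rule: measure_induct_rule[where f = "\<lambda>x. to_nat_on (UNIV :: 'a set) (of_widx x)"])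
    case (less x)
    show ?case by (rule that, rule less) (simp add: less_widx_def)
  qed
qed

end

section \<open>Determinants of perturbed identity matrices\<close>

lemma prod_one_plus_ge_exp:
  fixes a :: "'a \<Rightarrow> real"
  assumes "finite I" "\<And>i. i \<in> I \<Longrightarrow> \<bar>a i\<bar> \<le> b" "b \<le> 1/2"
  shows "exp (sum a I - 2 * real (card I) * b\<^sup>2) \<le> (\<Prod>i\<in>I. 1 + a i)"
proof -
  have "exp (a i - 2 * b\<^sup>2) \<le> 1 + a i" if "i \<in> I" for i
  proof -
    have "\<bar>ln (1 + a i) - a i\<bar> \<le> 2 * (a i)\<^sup>2"
      using assms(2)[OF that] assms(3) by (intro abs_ln_one_plus_x_minus_x_bound) linarith
    moreover have "(a i)\<^sup>2 \<le> b\<^sup>2"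
      using assms(2)[OF that] abs_le_square_iff[of "a i" b] by linarith
    ultimately have "a i - 2 * b\<^sup>2 \<le> ln (1 + a i)" by linarith
    then show ?thesis
      using assms(2)[OF that] assms(3) by (subst ln_ge_iff[symmetric]) auto
  qed
  then have "(\<Prod>i\<in>I. exp (a i - 2 * b\<^sup>2)) \<le> (\<Prod>i\<in>I. 1 + a i)"
    by (intro prod_mono) auto
  then show ?thesis
    using assms(1) by (simp add: exp_sum[symmetric] sum_subtractf mult_ac)
qed

text \<open>In the Leibniz expansion the identity permutation yields the diagonal product. Any other
  \<open>p\<close> moves some \<open>i\<close> and, being injective, also moves \<open>p i\<close>,
  so its term has two off-diagonal factors of size at most \<open>h * B\<close>. The other factors
  are at most \<open>1 + B\<close>, and there are \<open>fact CARD('n)\<close> permutations.\<close>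

lemma det_one_plus_minus_diagonal:
  fixes A :: "real^'n^'n"
  assumes B: "\<And>i j. \<bar>A $ i $ j\<bar> \<le> B" and h: "0 \<le> h" "h \<le> 1"
  shows "\<bar>det (mat 1 + h *\<^sub>R A) - (\<Prod>i\<in>UNIV. 1 + h * A $ i $ i)\<bar>
           \<le> fact CARD('n) * (B\<^sup>2 * (1 + B) ^ CARD('n)) * h\<^sup>2"
proof -
  have B0: "0 \<le> B" using B[of undefined undefined] by linarith
  let ?M = "mat 1 + h *\<^sub>R A" and ?P = "{p. p permutes (UNIV :: 'n set)}"
  define T where "T p = of_int (sign p) * (\<Prod>i\<in>UNIV. ?M $ i $ p i)" for p
  have fin: "finite ?P" by (simp add: finite_permutations)
  have d: "det ?M = T id + (\<Sum>p\<in>?P - {id}. T p)"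
    unfolding det_def T_def[symmetric] using fin by (subst sum.remove[of _ id]) (auto simp: permutes_id)
  have T_id: "T id = (\<Prod>i\<in>UNIV. 1 + h * A $ i $ i)"
    by (simp add: T_def mat_def)
  have "\<bar>T p\<bar> \<le> (B\<^sup>2 * (1 + B) ^ CARD('n)) * h\<^sup>2" if p: "p \<in> ?P - {id}" for p
  proof -
    have "bij p" using p permutes_bij by blast
    obtain i where i: "p i \<noteq> i" using p by (metis DiffE eq_id_iff singletonI)
    define j where "j = p i"
    have j: "p j \<noteq> j" "j \<noteq> i" using i \<open>bij p\<close> by (auto simp: j_def bij_def inj_def)
    have off: "\<bar>?M $ k $ p k\<bar> \<le> h * B" if "p k \<noteq> k" for k
      using that B[of k "p k"] h by (simp add: mat_def abs_mult mult_left_mono)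
    have any: "\<bar>?M $ k $ l\<bar> \<le> 1 + B" for k l
    proof -
      have "\<bar>h * A $ k $ l\<bar> \<le> B"
        using mult_mono[OF h(2) B[of k l]] h by (simp add: abs_mult)
      then show ?thesis by (auto simp: mat_def)
    qed
    have "\<bar>T p\<bar> = (\<Prod>k\<in>UNIV. \<bar>?M $ k $ p k\<bar>)"
      by (simp add: T_def abs_mult abs_prod sign_def)
    also have "\<dots> = \<bar>?M $ i $ p i\<bar> * (\<bar>?M $ j $ p j\<bar> * (\<Prod>k\<in>UNIV - {i} - {j}. \<bar>?M $ k $ p k\<bar>))"
      using j by (subst prod.remove[of _ i], simp, simp, subst prod.remove[of _ j]) auto
    also have "\<dots> \<le> (h * B) * ((h * B) * (\<Prod>k\<in>UNIV - {i} - {j}. 1 + B))"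
      using off[OF i] off[OF j(1)] any h B0
      by (intro mult_mono prod_mono prod_nonneg mult_nonneg_nonneg) auto
    also have "\<dots> \<le> (h * B) * ((h * B) * (1 + B) ^ CARD('n))"
      using h B0 by (intro mult_left_mono) (auto intro!: power_increasing card_mono)
    finally show ?thesis by (simp add: power2_eq_square mult_ac)
  qed
  then have "\<bar>\<Sum>p\<in>?P - {id}. T p\<bar> \<le> (\<Sum>p\<in>?P - {id}. (B\<^sup>2 * (1 + B) ^ CARD('n)) * h\<^sup>2)"
    by (intro order_trans[OF sum_abs] sum_mono)
  also have "\<dots> \<le> (\<Sum>p\<in>?P. (B\<^sup>2 * (1 + B) ^ CARD('n)) * h\<^sup>2)"
    using B0 fin by (intro sum_mono2) auto
  also have "\<dots> = fact CARD('n) * (B\<^sup>2 * (1 + B) ^ CARD('n)) * h\<^sup>2"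
    by (simp add: card_permutations[of UNIV "CARD('n)"])
  finally show ?thesis
    using d T_id by linarith
qed

text \<open>A one-step form of Liouville's formula. The second-order error sits in the exponent, so
  that over a product of many steps the errors simply add up.\<close>

lemma det_one_plus_ge_exp_trace:
  fixes B :: real
  assumes "0 \<le> B"
  obtains K h0 where "0 \<le> K" "0 < h0"
    "\<And>(A :: real^'n^'n) h. (\<And>i j. \<bar>A $ i $ j\<bar> \<le> B) \<Longrightarrow> 0 \<le> h \<Longrightarrow> h \<le> h0 \<Longrightarrow>
       exp (h * trace A - K * h\<^sup>2) \<le> det (mat 1 + h *\<^sub>R A)"
proof -
  define N where "N = real CARD('n)"
  define C where "C = fact CARD('n) * (B\<^sup>2 * (1 + B) ^ CARD('n))"
  have N: "1 \<le> N" unfolding N_def by (simp add: Suc_leI)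
  have C: "0 \<le> C" unfolding C_def using assms by simp
  \<comment> \<open>Chosen so that \<open>h \<le> h0\<close> gives
    \<open>h + 2 * (N * (h * B)) + 3 * (h * C) \<le> 1/2\<close>, the source of all smallness
    conditions below.\<close>
  define h0 where "h0 = 1 / (2 * (1 + 2 * N * B + 3 * C))"
  have D: "1 + 2 * N * B + 3 * C \<ge> 1" using N C assms by simp
  have main: "exp (h * trace A - (2 * N * B\<^sup>2 + 6 * C) * h\<^sup>2) \<le> det (mat 1 + h *\<^sub>R A)"
    if A: "\<And>i j. \<bar>A $ i $ j\<bar> \<le> B" and h: "0 \<le> h" "h \<le> h0" for A :: "real^'n^'n" and h
  proof -
    have "h * (1 + 2 * N * B + 3 * C) \<le> 1 / 2"
      using h D by (simp add: h0_def field_simps)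
    then have sum: "h + 2 * (N * (h * B)) + 3 * (h * C) \<le> 1/2" by (simp add: algebra_simps)
    have nn: "0 \<le> N * (h * B)" "0 \<le> h * C" "0 \<le> h * B" using N C assms h by auto
    have h1: "h \<le> 1" and NB: "N * (h * B) \<le> 1/4" and hC: "3 * (h * C) \<le> 1/2"
      using sum nn h(1) by linarith+
    have hB: "h * B \<le> 1/4"
      using NB mult_right_mono[OF N nn(3)] by linarith
    have hhC: "3 * C * h\<^sup>2 \<le> 1/2"
    proof -
      have "(h * C) * h \<le> (h * C) * 1" using h1 nn by (intro mult_left_mono) auto
      then show ?thesis using hC by (simp add: power2_eq_square mult_ac)
    qed
    define y where "y = h * trace A - 2 * N * B\<^sup>2 * h\<^sup>2"
    have abs_a: "\<bar>h * A $ i $ i\<bar> \<le> h * B" for i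
      using A[of i i] h by (simp add: abs_mult mult_left_mono)
    have "exp (sum (\<lambda>i. h * A $ i $ i) UNIV - 2 * real (card (UNIV :: 'n set)) * (h * B)\<^sup>2)
            \<le> (\<Prod>i\<in>UNIV. 1 + h * A $ i $ i)"
      using hB by (intro prod_one_plus_ge_exp abs_a) auto
    then have "exp y \<le> (\<Prod>i\<in>UNIV. 1 + h * A $ i $ i)"
      by (simp add: y_def N_def trace_def sum_distrib_left power_mult_distrib mult_ac)
    then have d1: "exp y - C * h\<^sup>2 \<le> det (mat 1 + h *\<^sub>R A)"
      using det_one_plus_minus_diagonal[OF A h(1) h1] unfolding C_def by linarith
    have "\<bar>h * trace A\<bar> \<le> N * (h * B)"
    proof -
      have "\<bar>\<Sum>i\<in>UNIV. h * A $ i $ i\<bar> \<le> (\<Sum>i\<in>(UNIV :: 'n set). h * B)"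
        by (intro order_trans[OF sum_abs] sum_mono abs_a)
      then show ?thesis by (simp add: trace_def sum_distrib_left N_def)
    qed
    moreover have "2 * N * B\<^sup>2 * h\<^sup>2 \<le> 1/2"
      using mult_mono[OF NB hB] nn by (simp add: power2_eq_square mult_ac)
    \<comment> \<open>The lower bound on \<open>y\<close> turns the additive error into a relative
      one: \<open>exp y \<ge> 1/3\<close> gives
      \<open>C * h\<^sup>2 \<le> exp y * (3 * C * h\<^sup>2)\<close>. Then
      \<open>1 - x \<ge> exp (- 2 * x)\<close> for \<open>x = 3 * C * h\<^sup>2\<close> moves it
      into the exponent.\<close>
    ultimately have "-1 \<le> y" unfolding y_def using NB by linarith
    then have "exp (-1) \<le> exp y" by simp
    moreover have "1/3 \<le> exp (-1 :: real)"
      using exp_le by (simp add: exp_minus field_simps)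
    ultimately have "1 \<le> 3 * exp y" by linarith
    then have "C * h\<^sup>2 * 1 \<le> C * h\<^sup>2 * (3 * exp y)" using C by (intro mult_left_mono) auto
    then have d2: "exp y * (1 - 3 * C * h\<^sup>2) \<le> det (mat 1 + h *\<^sub>R A)"
      using d1 by (simp add: algebra_simps)
    have "\<bar>ln (1 + (- (3 * C * h\<^sup>2))) - (- (3 * C * h\<^sup>2))\<bar> \<le> 2 * (- (3 * C * h\<^sup>2))\<^sup>2"
      using hhC C by (intro abs_ln_one_plus_x_minus_x_bound) auto
    moreover have "2 * (- (3 * C * h\<^sup>2))\<^sup>2 \<le> 3 * C * h\<^sup>2"
      using mult_left_mono[OF hhC, of "3 * C * h\<^sup>2"] C by (simp add: power2_eq_square)
    ultimately have "- (6 * C * h\<^sup>2) \<le> ln (1 - 3 * C * h\<^sup>2)" by simp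
    then have "exp (- (6 * C * h\<^sup>2)) \<le> 1 - 3 * C * h\<^sup>2"
      using hhC by (subst ln_ge_iff[symmetric]) auto
    then have "exp y * exp (- (6 * C * h\<^sup>2)) \<le> exp y * (1 - 3 * C * h\<^sup>2)"
      by simp
    also note d2
    finally show ?thesis
      by (simp add: y_def exp_add[symmetric] algebra_simps)
  qed
  show thesis
  proof (rule that[of "2 * N * B\<^sup>2 + 6 * C" h0])
    show "0 \<le> 2 * N * B\<^sup>2 + 6 * C" using N C by simp
    show "0 < h0" using D by (simp add: h0_def)
  qed (use main in blast)
qed

section \<open>Euler maps and their effect on volume\<close>

definition euler_step :: "('a::real_vector \<Rightarrow> 'a) \<Rightarrow> real \<Rightarrow> 'a \<Rightarrow> 'a" where
  "euler_step F h x = x + h *\<^sub>R F x"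

lemma euler_step_has_derivative:
  fixes F :: "real^'n \<Rightarrow> real^'n"
  assumes "(F has_derivative (\<lambda>v. A *v v)) (at x)"
  shows "(euler_step F h has_derivative (\<lambda>v. (mat 1 + h *\<^sub>R A) *v v)) (at x)"
proof -
  have "((\<lambda>x. x + h *\<^sub>R F x) has_derivative (\<lambda>v. v + h *\<^sub>R (A *v v))) (at x)"
    by (intro derivative_intros assms)
  then show ?thesis
    by (simp add: euler_step_def[abs_def] matrix_vector_mult_add_rdistrib scaleR_matrix_vector_assoc)
qed

lemma euler_iterate_has_derivative:
  fixes F :: "real^'n \<Rightarrow> real^'n"
  assumes der: "\<And>x. (F has_derivative (\<lambda>v. A x *v v)) (at x)"
  obtains D where "\<And>x. ((euler_step F h ^^ n) has_derivative (\<lambda>v. D x *v v)) (at x)"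
    "\<And>x. det (D x) = (\<Prod>k<n. det (mat 1 + h *\<^sub>R A ((euler_step F h ^^ k) x)))"
proof (induction n arbitrary: thesis)
  case 0
  show ?case
    by (rule 0[of "\<lambda>_. mat 1"]) (auto simp: id_def intro: has_derivative_ident)
next
  case (Suc n)
  obtain D where D: "\<And>x. ((euler_step F h ^^ n) has_derivative (\<lambda>v. D x *v v)) (at x)"
    "\<And>x. det (D x) = (\<Prod>k<n. det (mat 1 + h *\<^sub>R A ((euler_step F h ^^ k) x)))"
    using Suc.IH by blast
  let ?M = "\<lambda>x. mat 1 + h *\<^sub>R A ((euler_step F h ^^ n) x)"
  show ?case
  proof (rule Suc.prems[of "\<lambda>x. ?M x ** D x"])
    fix x
    show "((euler_step F h ^^ Suc n) has_derivative (\<lambda>v. (?M x ** D x) *v v)) (at x)"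
      using diff_chain_at[OF D(1)[of x] euler_step_has_derivative[OF der, of h]]
      by (simp add: o_def matrix_vector_mul_assoc)
    show "det (?M x ** D x) = (\<Prod>k<Suc n. det (mat 1 + h *\<^sub>R A ((euler_step F h ^^ k) x)))"
      by (simp add: det_mul D(2) mult.commute)
  qed
qed

text \<open>Two points with the same image satisfy \<open>x - y = h *\<^sub>R (F y - F x)\<close>,
  whose norm is at most \<open>h * L < 1\<close> times that of \<open>x - y\<close>.\<close>

lemma inj_euler_step:
  fixes F :: "'a::real_normed_vector \<Rightarrow> 'a"
  assumes lip: "\<And>x y. norm (F x - F y) \<le> L * norm (x - y)" and h: "0 \<le> h" "h * L < 1"
  shows "inj (euler_step F h)"
proof (rule injI, rule ccontr)
  fix x y assume "euler_step F h x = euler_step F h y" "x \<noteq> y"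
  then have "x - y = h *\<^sub>R (F y - F x)"
    by (simp add: euler_step_def algebra_simps)
  then have "norm (x - y) = h * norm (F y - F x)"
    using h by simp
  also have "\<dots> \<le> h * (L * norm (y - x))"
    using h by (intro mult_left_mono lip)
  also have "\<dots> < 1 * norm (x - y)"
    using h \<open>x \<noteq> y\<close> by (simp add: norm_minus_commute mult.assoc[symmetric])
  finally show False by simp
qed

text \<open>Change of variables for an injective map: the volume of the image is the integral of the
  Jacobian determinant, which by the chain rule is the product of the one-step determinants along
  the orbit.\<close>

lemma measure_euler_iterate_ge:
  fixes F :: "real^'n::{finite,wellorder} \<Rightarrow> real^'n::_"
  assumes der: "\<And>x. (F has_derivative (\<lambda>v. A x *v v)) (at x)"
    and lip: "\<And>x y. norm (F x - F y) \<le> L * norm (x - y)" and h: "0 \<le> h" "h * L < 1"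
    and S: "compact S"
    and M: "\<And>x. x \<in> S \<Longrightarrow> M \<le> (\<Prod>k<n. det (mat 1 + h *\<^sub>R A ((euler_step F h ^^ k) x)))"
  shows "M * measure lebesgue S \<le> measure lebesgue ((euler_step F h ^^ n) ` S)"
proof -
  let ?g = "euler_step F h ^^ n"
  obtain D where D: "\<And>x. (?g has_derivative (\<lambda>v. D x *v v)) (at x)"
    "\<And>x. det (D x) = (\<Prod>k<n. det (mat 1 + h *\<^sub>R A ((euler_step F h ^^ k) x)))"
    using euler_iterate_has_derivative[OF der] by blast
  have der_g: "(?g has_derivative (\<lambda>v. D x *v v)) (at x within S)" for x
    using D(1) has_derivative_at_withinI by blast
  have "inj ?g"
    using inj_euler_step[OF lip h] by (rule inj_fn)
  then have inj: "inj_on ?g S" by (rule inj_on_subset) simp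
  have "continuous_on S ?g"
    using der_g by (meson continuous_on_eq_continuous_within has_derivative_continuous)
  then have "?g ` S \<in> lmeasurable"
    using S by (intro lmeasurable_compact compact_continuous_image)
  then have 1: "((\<lambda>x. \<bar>det (matrix (\<lambda>v. D x *v v))\<bar>) has_integral measure lebesgue (?g ` S)) S"
    using has_measure_differentiable_image[OF _ der_g inj] lmeasurable_compact[OF S] fmeasurableD by blast
  have "((\<lambda>x. 1) has_integral measure lebesgue S) S"
    using lmeasurable_compact[OF S] lmeasurable_iff_has_integral lmeasure_integral
      by (simp add: lmeasurable_iff_integrable_on lmeasure_integral integrable_integral)
  then have 2: "((\<lambda>x. M * 1) has_integral M * measure lebesgue S) S"
    by (rule has_integral_mult_right)
  show ?thesis
  proof (rule has_integral_le[OF 2 1])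
    fix x assume "x \<in> S"
    then have "M \<le> det (D x)" using M D(2) by simp
    then show "M * 1 \<le> \<bar>det (matrix (\<lambda>v. D x *v v))\<bar>" by (simp add: matrix_of_matrix_vector_mul)
  qed
qed

section \<open>Solutions and their Euler approximation\<close>

text \<open>The initial value is left free, so that sets of initial data can be written as sets of
  values \<open>\<theta> 0\<close>, without a flow map.\<close>

definition ode_solution :: "('a::real_normed_vector \<Rightarrow> 'a) \<Rightarrow> (real \<Rightarrow> 'a) \<Rightarrow> bool" where
  "ode_solution F \<theta> \<longleftrightarrow> continuous_on {0..} \<theta> \<and> (\<forall>t>0. (\<theta> has_vector_derivative F (\<theta> t)) (at t))"

lemma ode_solution_lipschitz:
  fixes F :: "'a::real_inner \<Rightarrow> 'a"
  assumes sol: "ode_solution F \<theta>" and bd: "\<And>x. norm (F x) \<le> C" and st: "0 \<le> s" "s \<le> t"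
  shows "norm (\<theta> t - \<theta> s) \<le> C * (t - s)"
proof (cases "s = t")
  case False
  then have "s < t" using st by simp
  have "\<exists>x\<in>{s<..<t}. norm (\<theta> t - \<theta> s) \<le> norm ((t - s) *\<^sub>R F (\<theta> x))"
  proof (rule mvt_general[OF \<open>s < t\<close>, where f' = "\<lambda>x v. v *\<^sub>R F (\<theta> x)"])
    show "continuous_on {s..t} \<theta>"
      using sol st continuous_on_subset[of "{0..}" \<theta> "{s..t}"] by (auto simp: ode_solution_def)
  qed (use sol st in \<open>auto simp: ode_solution_def has_vector_derivative_def\<close>)
  then show ?thesis
    using \<open>s < t\<close> bd by (force simp: mult.commute intro: order_trans mult_right_mono)
qed simp

text \<open>Subtracting the tangent direction at \<open>s\<close> leaves a function \<open>f\<close>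
  with derivative \<open>F (\<theta> x) - F (\<theta> s)\<close>, of norm at most
  \<open>L * C * h\<close> because the speed is at most \<open>C\<close>.\<close>

lemma euler_local_error:
  fixes F :: "'a::real_inner \<Rightarrow> 'a"
  assumes sol: "ode_solution F \<theta>" and bd: "\<And>x. norm (F x) \<le> C"
    and lip: "\<And>x y. norm (F x - F y) \<le> L * norm (x - y)" and "0 \<le> L" and st: "0 \<le> s" "0 \<le> h"
  shows "norm (\<theta> (s + h) - euler_step F h (\<theta> s)) \<le> L * C * h\<^sup>2"
proof (cases "h = 0")
  case False
  then have "s < s + h" using st by simp
  define f where "f u = \<theta> u - u *\<^sub>R F (\<theta> s)" for u
  have "\<exists>x\<in>{s<..<s + h}. norm (f (s + h) - f s) \<le> norm ((s + h - s) *\<^sub>R (F (\<theta> x) - F (\<theta> s)))"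
  proof (rule mvt_general[OF \<open>s < s + h\<close>, where f' = "\<lambda>x v. v *\<^sub>R (F (\<theta> x) - F (\<theta> s))"])
    have "continuous_on {s..s + h} \<theta>"
      using sol st continuous_on_subset[of "{0..}" \<theta> "{s..s + h}"] by (auto simp: ode_solution_def)
    then show "continuous_on {s..s + h} f"
      unfolding f_def by (intro continuous_intros)
    fix x assume "s < x" "x < s + h"
    then have "(\<theta> has_vector_derivative F (\<theta> x)) (at x)"
      using sol st by (auto simp: ode_solution_def)
    then have "(f has_vector_derivative F (\<theta> x) - F (\<theta> s)) (at x)"
      unfolding f_def by (auto intro!: derivative_eq_intros)
    then show "(f has_derivative (\<lambda>v. v *\<^sub>R (F (\<theta> x) - F (\<theta> s)))) (at x)"
      by (simp add: has_vector_derivative_def)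
  qed
  then obtain x where x: "s < x" "x < s + h"
    and le: "norm (f (s + h) - f s) \<le> h * norm (F (\<theta> x) - F (\<theta> s))"
    using st by auto
  have C: "0 \<le> C" using bd norm_ge_zero order_trans by blast
  have "norm (F (\<theta> x) - F (\<theta> s)) \<le> L * norm (\<theta> x - \<theta> s)" by (rule lip)
  also have "\<dots> \<le> L * (C * (x - s))"
    using ode_solution_lipschitz[OF sol bd, of s x] x st \<open>0 \<le> L\<close> by (intro mult_left_mono) auto
  also have "\<dots> \<le> L * (C * h)"
    using x C \<open>0 \<le> L\<close> by (intro mult_left_mono) auto
  finally have "h * norm (F (\<theta> x) - F (\<theta> s)) \<le> h * (L * (C * h))"
    using st by (intro mult_left_mono) auto
  moreover have "f (s + h) - f s = \<theta> (s + h) - euler_step F h (\<theta> s)"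
    by (simp add: f_def euler_step_def algebra_simps)
  ultimately show ?thesis
    using le by (simp add: power2_eq_square mult_ac)
qed (simp add: euler_step_def)

text \<open>Each step enlarges the inherited error by a factor of at most \<open>1 + h * L\<close>
  and adds one local error. For \<open>k * h \<le> t\<close> the bound is at most
  \<open>t * L * C * exp (L * t) * h\<close>, hence linear in \<open>h\<close>.\<close>

lemma euler_iterate_error:
  fixes F :: "'a::real_inner \<Rightarrow> 'a"
  assumes sol: "ode_solution F \<theta>" and bd: "\<And>x. norm (F x) \<le> C"
    and lip: "\<And>x y. norm (F x - F y) \<le> L * norm (x - y)" and "0 \<le> L" and h: "0 \<le> h"
  shows "norm ((euler_step F h ^^ k) (\<theta> 0) - \<theta> (k * h)) \<le> k * (L * C * h\<^sup>2) * (1 + h * L) ^ k"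
proof (induction k)
  case (Suc k)
  let ?x = "(euler_step F h ^^ k) (\<theta> 0)" and ?y = "\<theta> (k * h)" and ?e = "L * C * h\<^sup>2"
  have "0 \<le> C" using bd norm_ge_zero order_trans by blast
  then have e0: "0 \<le> ?e" using \<open>0 \<le> L\<close> by simp
  have "norm (euler_step F h ?x - euler_step F h ?y) = norm ((?x - ?y) + h *\<^sub>R (F ?x - F ?y))"
    by (simp add: euler_step_def algebra_simps)
  also have "\<dots> \<le> norm (?x - ?y) + h * norm (F ?x - F ?y)"
    using norm_triangle_ineq h by (metis abs_of_nonneg norm_scaleR)
  also have "\<dots> \<le> norm (?x - ?y) + h * (L * norm (?x - ?y))"
    using h lip by (intro add_left_mono mult_left_mono) auto
  also have "\<dots> = norm (?x - ?y) * (1 + h * L)" by (simp add: algebra_simps)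
  also have "\<dots> \<le> k * ?e * (1 + h * L) ^ k * (1 + h * L)"
    using Suc h \<open>0 \<le> L\<close> by (intro mult_right_mono) auto
  finally have 1: "norm (euler_step F h ?x - euler_step F h ?y) \<le> k * ?e * (1 + h * L) ^ Suc k"
    by (simp add: mult_ac)
  have "norm (\<theta> (k * h + h) - euler_step F h ?y) \<le> ?e"
    using h by (intro euler_local_error[OF sol bd lip \<open>0 \<le> L\<close>]) auto
  also have "\<dots> \<le> ?e * (1 + h * L) ^ Suc k"
    using mult_left_mono[OF one_le_power[of "1 + h * L" "Suc k"] e0] h \<open>0 \<le> L\<close> by simp
  finally have 2: "norm (euler_step F h ?y - \<theta> (k * h + h)) \<le> ?e * (1 + h * L) ^ Suc k"
    by (simp add: norm_minus_commute)
  have "norm (euler_step F h ?x - \<theta> (k * h + h)) \<le> k * ?e * (1 + h * L) ^ Suc k + ?e * (1 + h * L) ^ Suc k"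
    using norm_triangle_le[OF add_mono[OF 1 2]] by simp
  then show ?case by (simp add: algebra_simps)
qed simp

lemma euler_iterate_norm_le:
  assumes bd: "\<And>x. norm (F x) \<le> C" and h: "0 \<le> h"
  shows "norm ((euler_step F h ^^ k) x) \<le> norm x + k * h * C"
proof (induction k)
  case (Suc k)
  let ?x = "(euler_step F h ^^ k) x"
  have "norm (euler_step F h ?x) \<le> norm ?x + h * norm (F ?x)"
    unfolding euler_step_def using norm_triangle_ineq h by (metis abs_of_nonneg norm_scaleR)
  also have "\<dots> \<le> norm x + k * h * C + h * C"
    using Suc bd h by (intro add_mono mult_left_mono) auto
  finally show ?case by (simp add: algebra_simps)
qed simp

section \<open>Trajectories confined to an expanding region\<close>

lemma ball_volume_times_exp_tendsto_0:
  fixes C c r :: real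
  assumes "0 < C" "0 < c"
  shows "((\<lambda>t. exp (b - c * t) * measure lebesgue (cball (0 :: 'a::euclidean_space) (r + C * t))) \<longlongrightarrow> 0) at_top"
proof -
  define d where "d = DIM('a)"
  \<comment> \<open>\<open>k\<close> collects the constants so that the product becomes
    \<open>k * (s ^ d / exp s)\<close> with \<open>s = c / C * (r + C * t)\<close>.\<close>
  define k where "k = exp (b + c * r / C) * unit_ball_vol (real d) * (C / c) ^ d"
  have lim: "filterlim (\<lambda>t. c / C * (r + C * t)) at_top at_top"
    using assms by real_asymp
  have "((\<lambda>t. k * ((c / C * (r + C * t)) ^ d / exp (c / C * (r + C * t)))) \<longlongrightarrow> k * 0) at_top"
    by (intro tendsto_intros filterlim_compose[OF tendsto_power_div_exp_0 lim])
  moreover have "\<forall>\<^sub>F t in at_top. k * ((c / C * (r + C * t)) ^ d / exp (c / C * (r + C * t))) =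
       exp (b - c * t) * measure lebesgue (cball (0 :: 'a) (r + C * t))"
    using eventually_ge_at_top[of "\<bar>r\<bar> / C"]
  proof eventually_elim
    case (elim t)
    then have "0 \<le> r + C * t" using assms by (simp add: field_simps)
    then have 1: "measure lebesgue (cball (0 :: 'a) (r + C * t)) = unit_ball_vol (real d) * (r + C * t) ^ d"
      by (simp add: content_cball d_def)
    have 2: "(C / c) ^ d * (c / C * (r + C * t)) ^ d = (r + C * t) ^ d"
      using assms by (simp add: power_mult_distrib[symmetric])
    have "c / C * (r + C * t) = c * r / C + c * t" using assms by (simp add: field_simps)
    then have 3: "exp (b + c * r / C) / exp (c / C * (r + C * t)) = exp (b - c * t)"
      by (simp add: exp_diff[symmetric])
    have "k * ((c / C * (r + C * t)) ^ d / exp (c / C * (r + C * t))) =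
      (exp (b + c * r / C) / exp (c / C * (r + C * t))) * unit_ball_vol (real d) * ((C / c) ^ d * (c / C * (r + C * t)) ^ d)"
      by (simp add: k_def)
    then show ?case unfolding 1 2 3 by simp
  qed
  ultimately show ?thesis
    by (simp add: filterlim_cong)
qed

text \<open>Trajectories that stay \<open>\<eta>\<close>-deep in \<open>Q\<close> are followed by
  Euler iterates in \<open>Q\<close> when the step is small. There each step expands volume by
  \<open>exp (c * h)\<close>, up to second-order errors and the increment of the bounded function
  \<open>g\<close>. After time \<open>t\<close> the volume has grown by a factor of at least
  \<open>exp (c * t - 1 - 2 * G)\<close>, yet the image lies in a ball of radius
  \<open>r + C * t\<close>, so the initial set is covered by compact sets of arbitrarily small
  measure. The correction \<open>g\<close> admits regions in which the divergence is not bounded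
  away from 0.\<close>

lemma negligible_expanding_trajectories:
  fixes F :: "real^'n::{finite,wellorder} \<Rightarrow> real^'n::_"
  assumes der: "\<And>x. (F has_derivative (\<lambda>v. A x *v v)) (at x)"
    and lip: "\<And>x y. norm (F x - F y) \<le> L * norm (x - y)" and L: "0 \<le> L"
    and bd: "\<And>x. norm (F x) \<le> C" and C: "0 < C"
    and A: "\<And>x i j. \<bar>A x $ i $ j\<bar> \<le> B"
    and Q: "closed Q" and g: "\<And>x. \<bar>g x\<bar> \<le> G" and c: "0 < c" and K: "0 \<le> K"
    and growth: "\<And>x h. x \<in> Q \<Longrightarrow> 0 \<le> h \<Longrightarrow>
      c * h - K * h\<^sup>2 \<le> g (euler_step F h x) - g x + h * trace (A x)"
    and \<eta>: "0 < \<eta>"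
  shows "negligible {\<theta> 0 |\<theta>. ode_solution F \<theta> \<and> (\<forall>t\<ge>0. cball (\<theta> t) \<eta> \<subseteq> Q)}" (is "negligible ?E")
proof -
  have "0 \<le> B" using A[of undefined undefined undefined] by linarith
  then obtain K1 h0 where K1: "0 \<le> K1" "0 < h0"
    "\<And>(M :: real^'n::_^'n::_) h. (\<And>i j. \<bar>M $ i $ j\<bar> \<le> B) \<Longrightarrow> 0 \<le> h \<Longrightarrow> h \<le> h0 \<Longrightarrow>
       exp (h * trace M - K1 * h\<^sup>2) \<le> det (mat 1 + h *\<^sub>R M)"
    using det_one_plus_ge_exp_trace by blast
  have "negligible (?E \<inter> cball 0 (real r))" for r :: nat
    unfolding negligible_outer_le
  proof (intro allI impI)
    fix e :: real assume e: "0 < e"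
    have "\<forall>\<^sub>F t in at_top. exp (2 * G + 1 - c * t) * measure lebesgue (cball (0 :: real^'n::_) (r + C * t)) < e"
      by (rule order_tendstoD(2)[OF ball_volume_times_exp_tendsto_0[OF C c] e])
    then have "\<forall>\<^sub>F t in at_top. 0 < t \<and>
        exp (2 * G + 1 - c * t) * measure lebesgue (cball (0 :: real^'n::_) (r + C * t)) < e"
      using eventually_gt_at_top[of "0::real"] by eventually_elim auto
    then obtain t where t: "0 < t"
      and te: "exp (2 * G + 1 - c * t) * measure lebesgue (cball (0 :: real^'n::_) (r + C * t)) < e"
      using eventually_happens'[OF trivial_limit_at_top_linorder] by blast
    have lim: "(\<lambda>n. t / real n) \<longlonglongrightarrow> 0"
      by (rule lim_const_over_n)
    have small: "\<forall>\<^sub>F n in sequentially. a * (t / real n) < b" if "0 < b" for a b :: real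
    proof -
      have "(\<lambda>n. a * (t / real n)) \<longlonglongrightarrow> a * 0" by (intro tendsto_intros lim)
      then show ?thesis using that order_tendstoD(2) by fastforce
    qed
    \<comment> \<open>The conditions on \<open>t / real n\<close> provide, in turn, the determinant
      bound, injectivity of the step, an Euler error below \<open>\<eta>\<close>, and a total
      second-order loss of at most 1.\<close>
    have "\<forall>\<^sub>F n in sequentially. 0 < n \<and> 1 * (t / real n) < h0 \<and> L * (t / real n) < 1 \<and>
        (t * L * C * exp (L * t)) * (t / real n) < \<eta> \<and> ((K + K1) * t) * (t / real n) < 1"
      by (intro eventually_conj eventually_gt_at_top small) (use K1 \<eta> in auto)
    from eventually_happens'[OF sequentially_bot this]
    obtain n where n: "0 < n" "1 * (t / real n) < h0" "L * (t / real n) < 1"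
      "(t * L * C * exp (L * t)) * (t / real n) < \<eta>" "((K + K1) * t) * (t / real n) < 1"
      by blast
    define h where "h = t / n"
    have h: "0 < h" "h \<le> h0" "h * L < 1" "t * L * C * exp (L * t) * h \<le> \<eta>" "(K + K1) * t * h \<le> 1"
      and nh: "n * h = t"
      using n t by (auto simp: h_def mult.commute)
    let ?\<psi> = "\<lambda>k. euler_step F h ^^ k"
    \<comment> \<open>Defined through Euler iterates instead of trajectories: this makes
      \<open>S\<close> compact and gives the expansion at every point of it.\<close>
    define S where "S = cball 0 (real r) \<inter> (\<Inter>k<n. ?\<psi> k -` Q)"
    have "continuous_on UNIV (?\<psi> k)" for k
      by (rule euler_iterate_has_derivative[OF der, where h = h and n = k])
        (meson continuous_at_imp_continuous_on has_derivative_continuous)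
    then have "compact S"
      unfolding S_def using Q by (intro compact_Int_closed closed_INT ballI closed_vimage) auto
    have sub: "?E \<inter> cball 0 (real r) \<subseteq> S"
    proof
      fix x assume x: "x \<in> ?E \<inter> cball 0 (real r)"
      then obtain \<theta> where \<theta>: "x = \<theta> 0" "ode_solution F \<theta>" "\<And>t. 0 \<le> t \<Longrightarrow> cball (\<theta> t) \<eta> \<subseteq> Q" by blast
      have "?\<psi> k x \<in> Q" if "k < n" for k
      proof -
        have kh: "k * h \<le> t" using that h nh mult_right_mono[of "real k" "real n" h] by simp
        have "norm (?\<psi> k (\<theta> 0) - \<theta> (k * h)) \<le> k * (L * C * h\<^sup>2) * (1 + h * L) ^ k"
          using h by (intro euler_iterate_error[OF \<theta>(2) bd lip L]) auto
        also have "\<dots> \<le> (k * h) * (L * C * h) * exp (L * t)"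
        proof -
          have "(1 + h * L) ^ k \<le> exp (h * L) ^ k"
            using h L by (intro power_mono exp_ge_add_one_self) auto
          also have "\<dots> = exp ((k * h) * L)" by (simp add: exp_of_nat_mult[symmetric] mult_ac)
          also have "\<dots> \<le> exp (L * t)" using kh L by (simp add: mult_right_mono mult.commute[of L])
          finally have "k * (L * C * h\<^sup>2) * (1 + h * L) ^ k \<le> k * (L * C * h\<^sup>2) * exp (L * t)"
            using C L by (intro mult_left_mono) auto
          then show ?thesis by (simp add: power2_eq_square mult_ac)
        qed
        also have "\<dots> \<le> t * (L * C * h) * exp (L * t)"
          using kh L C h by (intro mult_right_mono) auto
        also have "\<dots> \<le> \<eta>" using h by (simp add: mult_ac)
        finally have "?\<psi> k x \<in> cball (\<theta> (k * h)) \<eta>"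
          by (simp add: \<theta>(1) dist_norm norm_minus_commute)
        then show ?thesis using \<theta>(3)[of "k * h"] h by auto
      qed
      then show "x \<in> S" using x by (auto simp: S_def)
    qed
    have "exp (c * t - 1 - 2 * G) * measure lebesgue S \<le> measure lebesgue (?\<psi> n ` S)"
    proof (rule measure_euler_iterate_ge[OF der lip _ h(3) \<open>compact S\<close>])
      fix x assume x: "x \<in> S"
      have gk: "c * h - (K + K1) * h\<^sup>2 - (g (?\<psi> (Suc k) x) - g (?\<psi> k x)) \<le> h * trace (A (?\<psi> k x)) - K1 * h\<^sup>2"
        if "k < n" for k
        using growth[of "?\<psi> k x" h] x that h by (auto simp: S_def algebra_simps)
      \<comment> \<open>The increments of \<open>g\<close> telescope, so they cost at most
        \<open>2 * G\<close> however large \<open>n\<close> is; the second-order terms add up to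
        \<open>(K + K1) * t * h \<le> 1\<close>.\<close>
      have "(\<Sum>k<n. c * h - (K + K1) * h\<^sup>2 - (g (?\<psi> (Suc k) x) - g (?\<psi> k x)))
          = n * (c * h - (K + K1) * h\<^sup>2) - (g (?\<psi> n x) - g x)"
        using sum_lessThan_telescope[of "\<lambda>k. g (?\<psi> k x)" n] by (simp add: sum_subtractf)
      also have "n * (c * h - (K + K1) * h\<^sup>2) = c * t - (K + K1) * t * h"
        by (simp add: nh[symmetric] power2_eq_square algebra_simps)
      finally have "c * t - 1 - 2 * G \<le> (\<Sum>k<n. c * h - (K + K1) * h\<^sup>2 - (g (?\<psi> (Suc k) x) - g (?\<psi> k x)))"
        using h(5) g[of "?\<psi> n x"] g[of x] by linarith
      also have "\<dots> \<le> (\<Sum>k<n. h * trace (A (?\<psi> k x)) - K1 * h\<^sup>2)"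
        by (intro sum_mono gk) simp
      finally have "exp (c * t - 1 - 2 * G) \<le> (\<Prod>k<n. exp (h * trace (A (?\<psi> k x)) - K1 * h\<^sup>2))"
        by (simp add: exp_sum[symmetric])
      also have "\<dots> \<le> (\<Prod>k<n. det (mat 1 + h *\<^sub>R A (?\<psi> k x)))"
        using h by (intro prod_mono conjI K1(3) A) auto
      finally show "exp (c * t - 1 - 2 * G) \<le> (\<Prod>k<n. det (mat 1 + h *\<^sub>R A (?\<psi> k x)))" .
    qed (use h in auto)
    also have "\<dots> \<le> measure lebesgue (cball (0 :: real^'n::_) (r + C * t))"
    proof (rule measure_mono_fmeasurable)
      show "?\<psi> n ` S \<subseteq> cball 0 (r + C * t)"
      proof clarsimp
        fix x assume "x \<in> S"
        then show "norm (?\<psi> n x) \<le> r + C * t"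
          using euler_iterate_norm_le[where F = F and C = C and h = h and k = n and x = x, OF bd] h nh by (auto simp: S_def mult_ac)
      qed
      have "continuous_on S (?\<psi> n)"
        using \<open>continuous_on UNIV (?\<psi> n)\<close> continuous_on_subset by blast
      then show "?\<psi> n ` S \<in> sets lebesgue"
        using \<open>compact S\<close> by (intro fmeasurableD lmeasurable_compact compact_continuous_image)
    qed simp
    finally have "exp (2 * G + 1 - c * t) * (exp (c * t - 1 - 2 * G) * measure lebesgue S) < e"
      using te by (smt (verit) exp_gt_zero mult_left_mono)
    then have "measure lebesgue S \<le> e"
      by (simp add: mult.assoc[symmetric] exp_add[symmetric])
    then show "\<exists>T. ?E \<inter> cball 0 (real r) \<subseteq> T \<and> T \<in> lmeasurable \<and> measure lebesgue T \<le> e"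
      using sub lmeasurable_compact[OF \<open>compact S\<close>] by blast
  qed
  then have "negligible (\<Union>r::nat. ?E \<inter> cball 0 (real r))"
    by (rule negligible_Union_nat)
  moreover have "X \<subseteq> (\<Union>r::nat. X \<inter> cball 0 (real r))" for X :: "(real^'n::_) set"
    using real_arch_simple by auto
  ultimately show ?thesis by (rule negligible_subset)
qed

section \<open>Asymptotics of real functions\<close>

text \<open>Between the last time with \<open>u \<ge> b\<close> and the first later time with
  \<open>u \<le> a\<close>, the values lie strictly between \<open>a\<close> and \<open>b\<close>;
  so \<open>u\<close> is nondecreasing there and cannot drop from \<open>b\<close> to
  \<open>a\<close>. The sign of the derivative is demanded only inside the band, which is all that
  the barrier arguments below can offer.\<close>

lemma no_downcrossing:
  fixes u :: "real \<Rightarrow> real"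
  assumes cont: "continuous_on {s..t} u" and st: "s \<le> t"
    and der: "\<And>x. s < x \<Longrightarrow> x < t \<Longrightarrow> (u has_real_derivative u' x) (at x)"
    and pos: "\<And>x. s < x \<Longrightarrow> x < t \<Longrightarrow> a \<le> u x \<Longrightarrow> u x \<le> b \<Longrightarrow> 0 \<le> u' x"
    and "a < b" "b \<le> u s"
  shows "a < u t"
proof (rule ccontr)
  assume "\<not> a < u t"
  define X where "X = {s..t} \<inter> u -` {b..}"
  have "closed X" unfolding X_def by (intro continuous_closed_preimage cont) auto
  moreover have "bounded X" unfolding X_def by (simp add: bounded_Int)
  ultimately have "compact X" by (simp add: compact_eq_bounded_closed)
  moreover have "X \<noteq> {}" using assms(6) st by (auto simp: X_def)
  ultimately obtain p where p: "p \<in> X" "\<And>x. x \<in> X \<Longrightarrow> x \<le> p"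
    using compact_attains_sup[of X] by metis
  define Y where "Y = {p..t} \<inter> u -` {..a}"
  have cp: "continuous_on {p..t} u"
    using cont p(1) by (auto simp: X_def intro: continuous_on_subset)
  have "closed Y" unfolding Y_def by (intro continuous_closed_preimage cp) auto
  moreover have "bounded Y" unfolding Y_def by (simp add: bounded_Int)
  ultimately have "compact Y" by (simp add: compact_eq_bounded_closed)
  moreover have "Y \<noteq> {}" using \<open>\<not> a < u t\<close> p(1) by (auto simp: X_def Y_def)
  ultimately obtain q where q: "q \<in> Y" "\<And>x. x \<in> Y \<Longrightarrow> q \<le> x"
    using compact_attains_inf[of Y] by metis
  have pq: "s \<le> p" "p \<le> q" "q \<le> t" "b \<le> u p" "u q \<le> a"
    using p q by (auto simp: X_def Y_def)
  have "u p \<le> u q"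
  proof (rule DERIV_nonneg_imp_increasing_open[of p q u])
    show "p \<le> q" by fact
    show "continuous_on {p..q} u" using cp pq by (auto intro: continuous_on_subset)
    fix x assume x: "p < x" "x < q"
    have "x \<notin> X" "x \<notin> Y" using p(2)[of x] q(2)[of x] x by auto
    then have "u x < b" "a < u x" using x pq by (auto simp: X_def Y_def)
    then show "\<exists>y. (u has_real_derivative y) (at x) \<and> 0 \<le> y"
      using der[of x] pos[of x] x pq by (metis less_imp_le order.strict_trans1 order.strict_trans2)
  qed
  then show False using pq \<open>a < b\<close> by linarith
qed

text \<open>\<open>h\<close> increases to its supremum. If \<open>\<bar>f t\<bar> \<ge> e\<close> at
  a late time, the Lipschitz bound keeps \<open>\<bar>f\<bar> \<ge> e / 2\<close> for a further time
  \<open>d = e / (2 * K')\<close>, and \<open>h\<close> would rise by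
  \<open>d * (e/2)\<^sup>2\<close>, past that supremum.\<close>

lemma barbalat_square:
  fixes f h h' :: "real \<Rightarrow> real"
  assumes lip: "\<And>s t. T \<le> s \<Longrightarrow> s \<le> t \<Longrightarrow> \<bar>f t - f s\<bar> \<le> K * (t - s)"
    and der: "\<And>t. T \<le> t \<Longrightarrow> (h has_real_derivative h' t) (at t)"
    and ge: "\<And>t. T \<le> t \<Longrightarrow> (f t)\<^sup>2 \<le> h' t"
    and bd: "\<And>t. T \<le> t \<Longrightarrow> h t \<le> M"
  shows "(f \<longlongrightarrow> 0) at_top"
proof -
  have mono: "h s \<le> h t" if "T \<le> s" "s \<le> t" for s t
  proof (rule DERIV_nonneg_imp_nondecreasing[OF that(2)])
    fix x assume "s \<le> x" "x \<le> t"
    then show "\<exists>y. (h has_real_derivative y) (at x) \<and> 0 \<le> y"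
      using der[of x] ge[of x] that by (metis order_trans zero_le_power2)
  qed
  define S where "S = (SUP t\<in>{T..}. h t)"
  have bdd: "bdd_above (h ` {T..})" using bd by (auto intro!: bdd_aboveI)
  have le_S: "h t \<le> S" if "T \<le> t" for t
    unfolding S_def using that bdd by (intro cSUP_upper) auto
  define K' where "K' = max K 1"
  have lip': "\<bar>f t - f s\<bar> \<le> K' * (t - s)" if "T \<le> s" "s \<le> t" for s t
    using lip[OF that] mult_right_mono[of K K' "t - s"] that by (simp add: K'_def)
  have K': "0 < K'" by (simp add: K'_def)
  show ?thesis
  proof (rule tendstoI)
    fix e :: real assume e: "0 < e"
    define d where "d = e / (2 * K')"
    have d: "0 < d" using e K' by (simp add: d_def)
    have "0 < d * (e/2)\<^sup>2" using d e by simp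
    then obtain t0 where t0: "T \<le> t0" "S - d * (e/2)\<^sup>2 < h t0"
      using less_cSUP_iff[OF _ bdd, of "S - d * (e/2)\<^sup>2"] unfolding S_def by auto
    have "\<bar>f t\<bar> < e" if t: "t0 \<le> t" for t
    proof (rule ccontr)
      assume ft: "\<not> \<bar>f t\<bar> < e"
      have "h t + (e/2)\<^sup>2 * d \<le> h (t + d)"
      proof -
        have "h t - (e/2)\<^sup>2 * t \<le> h (t + d) - (e/2)\<^sup>2 * (t + d)"
        proof (rule DERIV_nonneg_imp_nondecreasing[where f = "\<lambda>s. h s - (e/2)\<^sup>2 * s"])
          show "t \<le> t + d" using d by simp
          fix x assume x: "t \<le> x" "x \<le> t + d"
          have "\<bar>f x - f t\<bar> \<le> K' * (x - t)" using t0 t x by (intro lip') auto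
          also have "\<dots> \<le> K' * d" using x K' by (intro mult_left_mono) auto
          also have "\<dots> = e / 2" using K' by (simp add: d_def)
          finally have "e / 2 \<le> \<bar>f x\<bar>" using ft by linarith
          then have "(e/2)\<^sup>2 \<le> (f x)\<^sup>2" using e by (simp add: abs_le_square_iff[symmetric])
          then have "0 \<le> h' x - (e/2)\<^sup>2" using ge[of x] t0 t x by linarith
          moreover have "((\<lambda>s. h s - (e/2)\<^sup>2 * s) has_real_derivative h' x - (e/2)\<^sup>2) (at x)"
            using t0 t x by (auto intro!: derivative_eq_intros der)
          ultimately show "\<exists>y. ((\<lambda>s. h s - (e/2)\<^sup>2 * s) has_real_derivative y) (at x) \<and> 0 \<le> y" by blast
        qed
        then show ?thesis by (simp add: algebra_simps)
      qed
      moreover have "h t0 \<le> h t" using t0 t by (intro mono) auto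
      moreover have "h (t + d) \<le> S" using t0 t d by (intro le_S) auto
      ultimately show False using t0 by (simp add: mult.commute)
    qed
    then show "\<forall>\<^sub>F t in at_top. dist (f t) 0 < e"
      by (auto simp: eventually_at_top_linorder)
  qed
qed

text \<open>\<open>G (f t)\<close> is eventually closer to 0 than \<open>G r\<close> is, so
  \<open>f\<close> avoids the value \<open>r\<close> and, by the intermediate value theorem, stays
  on one side of it.\<close>

lemma eventually_one_sided:
  fixes f G :: "real \<Rightarrow> real"
  assumes cont: "continuous_on {T..} f" and lim: "((\<lambda>t. G (f t)) \<longlongrightarrow> 0) at_top"
    and "G r \<noteq> 0"
  shows "(\<forall>\<^sub>F t in at_top. f t < r) \<or> (\<forall>\<^sub>F t in at_top. r < f t)"
proof -
  have "\<forall>\<^sub>F t in at_top. dist (G (f t)) 0 < \<bar>G r\<bar>"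
    using lim assms(3) by (intro tendstoD) auto
  then have "\<forall>\<^sub>F t in at_top. f t \<noteq> r"
    by eventually_elim auto
  then obtain T0 where T0: "\<And>t. T0 \<le> t \<Longrightarrow> f t \<noteq> r" by (auto simp: eventually_at_top_linorder)
  define T1 where "T1 = max T0 T"
  have ne: "f t \<noteq> r" if "T1 \<le> t" for t using T0 that by (simp add: T1_def)
  have c: "continuous_on {T1..t} f" for t using cont by (rule continuous_on_subset) (auto simp: T1_def)
  show ?thesis
  proof (cases "f T1 < r")
    case True
    have "f t < r" if "T1 \<le> t" for t
      using IVT'[of f T1 r t, OF _ _ that c] True ne by (metis linorder_not_less order.order_iff_strict)
    then show ?thesis by (auto simp: eventually_at_top_linorder)
  next
    case False
    have "r < f t" if "T1 \<le> t" for t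
      using IVT2'[of f t r T1, OF _ _ that c] False ne by (metis linorder_not_less order.order_iff_strict)
    then show ?thesis by (auto simp: eventually_at_top_linorder)
  qed
qed

text \<open>If the lower and upper limits differed, \<open>f\<close> would be found on both sides of
  every level strictly between them at arbitrarily late times. The limit is the supremum of the
  levels that \<open>f\<close> eventually exceeds.\<close>

lemma convergent_if_eventually_one_sided:
  fixes f :: "real \<Rightarrow> real"
  assumes dense: "\<And>x y. x < y \<Longrightarrow>
      \<exists>r. x < r \<and> r < y \<and> ((\<forall>\<^sub>F t in at_top. f t < r) \<or> (\<forall>\<^sub>F t in at_top. r < f t))"
    and bd: "\<forall>\<^sub>F t in at_top. a < f t \<and> f t < b"
  shows "\<exists>l. (f \<longlongrightarrow> l) at_top"
proof -
  define D where "D = {r. \<forall>\<^sub>F t in at_top. r < f t}"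
  have "a \<in> D" using bd by (auto simp: D_def elim: eventually_mono)
  have "r \<le> b" if "r \<in> D" for r
  proof -
    have "\<forall>\<^sub>F t in at_top. r < f t \<and> f t < b"
      using that bd unfolding D_def by (auto elim: eventually_elim2)
    then show ?thesis
      using eventually_happens'[OF trivial_limit_at_top_linorder] by fastforce
  qed
  then have bdd: "bdd_above D" by (rule bdd_aboveI)
  have "(f \<longlongrightarrow> Sup D) at_top"
  proof (rule order_tendstoI)
    fix x assume "x < Sup D"
    then obtain r where "r \<in> D" "x < r" using less_cSup_iff[OF _ bdd] \<open>a \<in> D\<close> by blast
    then show "\<forall>\<^sub>F t in at_top. x < f t" by (auto simp: D_def elim: eventually_mono)
  next
    fix x assume "Sup D < x"
    then obtain r where r: "Sup D < r" "r < x"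
      "(\<forall>\<^sub>F t in at_top. f t < r) \<or> (\<forall>\<^sub>F t in at_top. r < f t)" using dense by blast
    moreover have "r \<notin> D" using r(1) cSup_upper[OF _ bdd] by force
    ultimately have "\<forall>\<^sub>F t in at_top. f t < r" by (auto simp: D_def)
    then show "\<forall>\<^sub>F t in at_top. f t < x" by eventually_elim (use r in auto)
  qed
  then show ?thesis ..
qed

text \<open>On an interval of constancy the addition formulas for \<open>sin (z + d)\<close> and
  \<open>sin (z - d)\<close>, compared with \<open>sin z\<close>, would force
  \<open>sin z = 0\<close> and \<open>cos z = 0\<close>.\<close>

lemma sin_not_constant_on_interval:
  fixes x y s :: real
  assumes "x < y"
  shows "\<exists>r. x < r \<and> r < y \<and> sin r \<noteq> s"
proof (rule ccontr)
  assume "\<not> ?thesis"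
  then have eq: "sin r = s" if "x < r" "r < y" for r using that by blast
  define z d where "z = (x + y) / 2" and "d = min 1 ((y - x) / 4)"
  have d: "0 < d" "d \<le> 1" "x < z - d" "z + d < y"
    using assms by (auto simp: z_def d_def min_def field_simps split: if_splits)
  have "sin (z + d) = s" "sin (z - d) = s" "sin z = s"
    using d by (auto intro!: eq)
  then have "cos z * sin d = 0" "sin z * (1 - cos d) = 0"
    by (auto simp: sin_add sin_diff algebra_simps)
  moreover have "0 < sin d" "cos d < 1"
    using d pi_gt3 cos_monotone_0_pi[of 0 d] by (auto intro!: sin_gt_zero)
  ultimately have "cos z = 0" "sin z = 0" by auto
  then show False using sin_cos_squared_add[of z] by simp
qed

lemma sin_tendsto_imp_convergent:
  fixes f :: "real \<Rightarrow> real"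
  assumes cont: "continuous_on {T..} f" and lim: "((\<lambda>t. sin (f t)) \<longlongrightarrow> s) at_top"
    and bd: "\<forall>\<^sub>F t in at_top. a < f t \<and> f t < b"
  shows "\<exists>l. (f \<longlongrightarrow> l) at_top"
proof (rule convergent_if_eventually_one_sided[OF _ bd])
  fix x y :: real assume "x < y"
  then obtain r where "x < r" "r < y" "sin r - s \<noteq> 0"
    using sin_not_constant_on_interval[of x y s] by auto
  moreover have "((\<lambda>t. sin (f t) - s) \<longlongrightarrow> 0) at_top"
    using lim by (simp add: LIM_zero)
  ultimately show "\<exists>r>x. r < y \<and> ((\<forall>\<^sub>F t in at_top. f t < r) \<or> (\<forall>\<^sub>F t in at_top. r < f t))"
    using eventually_one_sided[OF cont, where G = "\<lambda>x. sin x - s"] by blast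
qed

section \<open>The Winfree field\<close>

lemma abs_sin_diff_le: "\<bar>sin a - sin b\<bar> \<le> \<bar>a - b\<bar>" for a b :: real
proof -
  have "\<bar>sin a - sin b\<bar> = 2 * \<bar>sin ((a - b) / 2)\<bar> * \<bar>cos ((a + b) / 2)\<bar>"
    by (simp add: sin_diff_sin abs_mult)
  also have "\<dots> \<le> 2 * \<bar>(a - b) / 2\<bar> * 1"
    by (intro mult_mono abs_sin_x_le_abs_x) auto
  finally show ?thesis by simp
qed

lemma abs_cos_diff_le: "\<bar>cos a - cos b\<bar> \<le> \<bar>a - b\<bar>" for a b :: real
  using abs_sin_diff_le[of "pi/2 - a" "pi/2 - b"] by (simp add: sin_diff)

lemma sin_add_linear_error: "\<bar>sin (a + b) - sin a - b * cos a\<bar> \<le> b\<^sup>2" for a b :: real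
proof (cases "b = 0")
  case False
  have "\<exists>x. \<bar>x - a\<bar> \<le> \<bar>b\<bar> \<and> sin (a + b) - sin a = b * cos x"
  proof (cases "0 < b")
    case True
    obtain z where "a < z" "z < a + b" "sin (a + b) - sin a = (a + b - a) * cos z"
      using MVT2[of a "a + b" sin cos] True by (auto intro: derivative_eq_intros)
    then show ?thesis using True by (intro exI[of _ z]) auto
  next
    case F: False
    then have "b < 0" using \<open>b \<noteq> 0\<close> by simp
    obtain z where "a + b < z" "z < a" "sin a - sin (a + b) = (a - (a + b)) * cos z"
      using MVT2[of "a + b" a sin cos] \<open>b < 0\<close> by (auto intro: derivative_eq_intros)
    then show ?thesis using \<open>b < 0\<close> by (intro exI[of _ z]) auto
  qed
  then obtain x where x: "\<bar>x - a\<bar> \<le> \<bar>b\<bar>" "sin (a + b) - sin a = b * cos x" by blast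
  have "\<bar>sin (a + b) - sin a - b * cos a\<bar> = \<bar>b\<bar> * \<bar>cos x - cos a\<bar>"
    by (simp add: x(2) abs_mult[symmetric] algebra_simps)
  also have "\<dots> \<le> \<bar>b\<bar> * \<bar>b\<bar>"
    using abs_cos_diff_le[of x a] x(1) by (intro mult_left_mono) auto
  finally show ?thesis by (simp add: power2_eq_square)
qed simp

lemma winfree_field_nth:
  "winfree_field \<omega> \<kappa> \<theta> $ i = \<omega> $ i - \<kappa> * winfree_R \<theta> * sin (\<theta> $ i)"
  by (simp add: winfree_field_def winfree_R_def)

lemma one_plus_cos_nonneg: "0 \<le> 1 + cos x" for x :: real
  using cos_ge_minus_one[of x] by linarith

lemma winfree_R_nonneg: "0 \<le> winfree_R \<theta>"
  unfolding winfree_R_def using one_plus_cos_nonneg by (intro mult_nonneg_nonneg sum_nonneg) auto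

lemma winfree_R_le_2: "winfree_R (\<theta> :: real^'n) \<le> 2"
proof -
  have "(\<Sum>j\<in>UNIV. 1 + cos (\<theta> $ j)) \<le> (\<Sum>j\<in>(UNIV :: 'n set). 2)"
    by (intro sum_mono) auto
  then show ?thesis by (simp add: winfree_R_def field_simps)
qed

lemma abs_winfree_R_le_2: "\<bar>winfree_R \<theta>\<bar> \<le> 2"
  using winfree_R_nonneg[of \<theta>] winfree_R_le_2[of \<theta>] by simp

lemma sum_cos_eq_winfree_R:
  "(\<Sum>j\<in>UNIV. cos (\<theta> $ j)) = real CARD('n) * (winfree_R \<theta> - 1)" for \<theta> :: "real^'n"
  by (simp add: winfree_R_def sum.distrib algebra_simps)

lemma one_plus_cos_le_winfree_R: "1 + cos (\<theta> $ i) \<le> real CARD('n) * winfree_R \<theta>" for \<theta> :: "real^'n"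
proof -
  have "1 + cos (\<theta> $ i) \<le> (\<Sum>j\<in>UNIV. 1 + cos (\<theta> $ j))"
    using one_plus_cos_nonneg by (intro member_le_sum) auto
  then show ?thesis by (simp add: winfree_R_def)
qed

lemma winfree_R_lipschitz: "\<bar>winfree_R x - winfree_R y\<bar> \<le> norm (x - y)" for x y :: "real^'n"
proof -
  have "\<bar>(\<Sum>j\<in>UNIV. 1 + cos (x $ j)) - (\<Sum>j\<in>UNIV. 1 + cos (y $ j))\<bar>
      = \<bar>\<Sum>j\<in>UNIV. cos (x $ j) - cos (y $ j)\<bar>"
    by (simp add: sum_subtractf sum.distrib)
  also have "\<dots> \<le> (\<Sum>j\<in>UNIV. \<bar>cos (x $ j) - cos (y $ j)\<bar>)" by (rule sum_abs)
  also have "\<dots> \<le> (\<Sum>j\<in>(UNIV :: 'n set). norm (x - y))"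
  proof (intro sum_mono)
    fix j
    show "\<bar>cos (x $ j) - cos (y $ j)\<bar> \<le> norm (x - y)"
      using abs_cos_diff_le[of "x $ j" "y $ j"] component_le_norm_cart[of "x - y" j] by simp
  qed
  finally show ?thesis
    by (simp add: winfree_R_def right_diff_distrib[symmetric] abs_mult field_simps)
qed

lemma winfree_field_lipschitz:
  fixes x y :: "real^'n"
  assumes "0 \<le> \<kappa>"
  shows "norm (winfree_field \<omega> \<kappa> x - winfree_field \<omega> \<kappa> y) \<le> 3 * \<kappa> * real CARD('n) * norm (x - y)"
proof -
  have "\<bar>(winfree_field \<omega> \<kappa> x - winfree_field \<omega> \<kappa> y) $ i\<bar> \<le> 3 * \<kappa> * norm (x - y)" for i
  proof -
    have "\<bar>winfree_R x * sin (x $ i) - winfree_R y * sin (y $ i)\<bar>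
        = \<bar>(winfree_R x - winfree_R y) * sin (x $ i) + winfree_R y * (sin (x $ i) - sin (y $ i))\<bar>"
      by (simp add: algebra_simps)
    also have "\<dots> \<le> \<bar>winfree_R x - winfree_R y\<bar> * \<bar>sin (x $ i)\<bar> + \<bar>winfree_R y\<bar> * \<bar>sin (x $ i) - sin (y $ i)\<bar>"
      by (metis abs_mult abs_triangle_ineq)
    also have "\<dots> \<le> norm (x - y) * 1 + 2 * norm (x - y)"
    proof (intro add_mono mult_mono)
      show "\<bar>sin (x $ i) - sin (y $ i)\<bar> \<le> norm (x - y)"
        using abs_sin_diff_le[of "x $ i" "y $ i"] component_le_norm_cart[of "x - y" i] by simp
    qed (use winfree_R_lipschitz abs_winfree_R_le_2 in auto)
    finally have "\<kappa> * \<bar>winfree_R x * sin (x $ i) - winfree_R y * sin (y $ i)\<bar> \<le> \<kappa> * (3 * norm (x - y))"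
      using assms by (intro mult_left_mono) auto
    then have "\<bar>\<kappa> * (winfree_R y * sin (y $ i) - winfree_R x * sin (x $ i))\<bar> \<le> \<kappa> * (3 * norm (x - y))"
      using assms by (simp add: abs_mult abs_minus_commute)
    then show ?thesis by (simp add: winfree_field_nth algebra_simps)
  qed
  then have "(\<Sum>i\<in>UNIV. \<bar>(winfree_field \<omega> \<kappa> x - winfree_field \<omega> \<kappa> y) $ i\<bar>)
      \<le> (\<Sum>i\<in>(UNIV :: 'n set). 3 * \<kappa> * norm (x - y))"
    by (intro sum_mono)
  then show ?thesis
    using norm_le_l1_cart[of "winfree_field \<omega> \<kappa> x - winfree_field \<omega> \<kappa> y"] by (simp add: mult_ac)
qed

lemma winfree_field_bounded:
  fixes x :: "real^'n"
  assumes "0 \<le> \<kappa>"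
  shows "norm (winfree_field \<omega> \<kappa> x) \<le> (\<Sum>i\<in>UNIV. \<bar>\<omega> $ i\<bar>) + 2 * \<kappa> * real CARD('n)"
proof -
  have "\<bar>winfree_field \<omega> \<kappa> x $ i\<bar> \<le> \<bar>\<omega> $ i\<bar> + 2 * \<kappa>" for i
  proof -
    have "\<bar>\<kappa> * winfree_R x * sin (x $ i)\<bar> \<le> \<kappa> * 2 * 1"
      unfolding abs_mult using assms abs_winfree_R_le_2 by (intro mult_mono) auto
    then show ?thesis
      unfolding winfree_field_nth by linarith
  qed
  then have "(\<Sum>i\<in>UNIV. \<bar>winfree_field \<omega> \<kappa> x $ i\<bar>) \<le> (\<Sum>i\<in>UNIV. \<bar>\<omega> $ i\<bar> + 2 * \<kappa>)"
    by (intro sum_mono)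
  then show ?thesis
    using norm_le_l1_cart[of "winfree_field \<omega> \<kappa> x"] by (simp add: sum.distrib mult_ac)
qed

section \<open>Jacobian and divergence of the field\<close>

text \<open>The rank-one term comes from differentiating \<open>winfree_R\<close> in the field, the
  diagonal term from differentiating the sine.\<close>

definition winfree_jac :: "real \<Rightarrow> real^'n \<Rightarrow> real^'n^'n" where
  "winfree_jac \<kappa> x = (\<chi> i j. \<kappa> / real CARD('n) * sin (x $ i) * sin (x $ j)
     - (if i = j then \<kappa> * winfree_R x * cos (x $ i) else 0))"

lemma winfree_R_has_derivative:
  fixes x :: "real^'n"
  shows "(winfree_R has_derivative (\<lambda>v. - (1 / real CARD('n)) * (\<Sum>j\<in>UNIV. sin (x $ j) * v $ j))) (at x)"
proof -
  have "((\<lambda>x. (1 / real CARD('n)) * (\<Sum>j\<in>UNIV. 1 + cos (x $ j))) has_derivative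
      (\<lambda>v. (1 / real CARD('n)) * (\<Sum>j\<in>UNIV. 0 + v $ j * - sin (x $ j)))) (at x)"
    by (intro derivative_intros has_derivative_cos bounded_linear_imp_has_derivative bounded_linear_vec_nth)
  then show ?thesis
    by (simp add: winfree_R_def[abs_def] sum_negf mult.commute)
qed

lemma winfree_field_has_derivative:
  fixes x :: "real^'n"
  shows "(winfree_field \<omega> \<kappa> has_derivative (\<lambda>v. winfree_jac \<kappa> x *v v)) (at x)"
proof (subst has_derivative_componentwise_within, intro ballI)
  fix b :: "real^'n" assume "b \<in> Basis"
  then obtain i where b: "b = axis i 1" by (auto simp: Basis_vec_def)
  have "((\<lambda>x. \<omega> $ i - \<kappa> * winfree_R x * sin (x $ i)) has_derivative
     (\<lambda>v. 0 - (\<kappa> * winfree_R x * (v $ i * cos (x $ i))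
       + (\<kappa> * (- (1 / real CARD('n)) * (\<Sum>j\<in>UNIV. sin (x $ j) * v $ j))) * sin (x $ i)))) (at x)"
    by (intro derivative_intros has_derivative_sin winfree_R_has_derivative
       bounded_linear_imp_has_derivative bounded_linear_vec_nth)
  moreover have "(winfree_jac \<kappa> x *v v) $ i = 0 - (\<kappa> * winfree_R x * (v $ i * cos (x $ i))
       + (\<kappa> * (- (1 / real CARD('n)) * (\<Sum>j\<in>UNIV. sin (x $ j) * v $ j))) * sin (x $ i))" for v
  proof -
    have "(winfree_jac \<kappa> x *v v) $ i = (\<Sum>j\<in>UNIV. \<kappa> / real CARD('n) * sin (x $ i) * (sin (x $ j) * v $ j)
        - (if i = j then \<kappa> * winfree_R x * cos (x $ i) * v $ j else 0))"
      unfolding matrix_vector_mult_def winfree_jac_def by (auto simp: algebra_simps intro!: sum.cong)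
    also have "\<dots> = \<kappa> / real CARD('n) * sin (x $ i) * (\<Sum>j\<in>UNIV. sin (x $ j) * v $ j)
        - \<kappa> * winfree_R x * cos (x $ i) * v $ i"
      by (simp add: sum_subtractf sum_distrib_left)
    finally show ?thesis by (simp add: algebra_simps)
  qed
  ultimately show "((\<lambda>x. winfree_field \<omega> \<kappa> x \<bullet> b) has_derivative (\<lambda>v. (winfree_jac \<kappa> x *v v) \<bullet> b)) (at x)"
    by (simp add: b inner_axis winfree_field_nth)
qed

lemma winfree_jac_bounded:
  fixes x :: "real^'n"
  assumes "0 \<le> \<kappa>"
  shows "\<bar>winfree_jac \<kappa> x $ i $ j\<bar> \<le> 3 * \<kappa>"
proof -
  define p where "p = \<kappa> / real CARD('n) * sin (x $ i) * sin (x $ j)"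
  define q where "q = \<kappa> * winfree_R x * cos (x $ i)"
  have "\<bar>p\<bar> \<le> \<kappa> / 1 * 1 * 1"
    unfolding p_def abs_mult abs_divide using assms by (intro mult_mono frac_le) (auto simp: Suc_leI)
  moreover have "\<bar>q\<bar> \<le> \<kappa> * 2 * 1"
    unfolding q_def abs_mult using assms abs_winfree_R_le_2 by (intro mult_mono) auto
  moreover have "winfree_jac \<kappa> x $ i $ j = p - (if i = j then q else 0)"
    by (simp add: winfree_jac_def p_def q_def)
  ultimately show ?thesis using assms by (cases "i = j") auto
qed

text \<open>The rank-one part contributes only squares to the trace and is dropped; the diagonal
  part is evaluated by \<open>sum_cos_eq_winfree_R\<close>.\<close>

lemma trace_winfree_jac_ge:
  fixes x :: "real^'n"
  assumes "0 \<le> \<kappa>"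
  shows "\<kappa> * real CARD('n) * winfree_R x * (1 - winfree_R x) \<le> trace (winfree_jac \<kappa> x)"
proof -
  have "trace (winfree_jac \<kappa> x) = (\<Sum>i\<in>UNIV. \<kappa> / real CARD('n) * (sin (x $ i))\<^sup>2)
      - \<kappa> * winfree_R x * (\<Sum>i\<in>UNIV. cos (x $ i))"
    by (simp add: trace_def winfree_jac_def sum_subtractf sum_distrib_left power2_eq_square mult_ac)
  moreover have "0 \<le> (\<Sum>i\<in>UNIV. \<kappa> / real CARD('n) * (sin (x $ i))\<^sup>2)"
    using assms by (intro sum_nonneg) auto
  ultimately show ?thesis by (simp add: sum_cos_eq_winfree_R algebra_simps)
qed

lemma winfree_solution_iff:
  "winfree_solution \<omega> \<kappa> x \<theta> \<longleftrightarrow> \<theta> 0 = x \<and> ode_solution (winfree_field \<omega> \<kappa>) \<theta>"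
  by (simp add: winfree_solution_def ode_solution_def)

lemma ode_solution_continuous_on:
  "ode_solution F \<theta> \<Longrightarrow> 0 \<le> s \<Longrightarrow> continuous_on {s..t} \<theta>"
  unfolding ode_solution_def by (auto intro: continuous_on_subset)

lemma winfree_theta_has_derivative:
  assumes "ode_solution (winfree_field \<omega> \<kappa>) \<theta>" "0 < t"
  shows "((\<lambda>t. \<theta> t $ i) has_real_derivative winfree_field \<omega> \<kappa> (\<theta> t) $ i) (at t)"
proof -
  have "(\<theta> has_vector_derivative winfree_field \<omega> \<kappa> (\<theta> t)) (at t)"
    using assms by (simp add: ode_solution_def)
  from bounded_linear.has_vector_derivative[OF bounded_linear_vec_nth[of i] this]
  show ?thesis by (simp add: has_real_derivative_iff_has_vector_derivative)
qed

lemma winfree_R_has_real_derivative: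
  fixes \<theta> :: "real \<Rightarrow> real^'n"
  assumes "ode_solution (winfree_field \<omega> \<kappa>) \<theta>" "0 < t"
  shows "((\<lambda>t. winfree_R (\<theta> t)) has_real_derivative
     - (1 / real CARD('n)) * (\<Sum>j\<in>UNIV. sin (\<theta> t $ j) * winfree_field \<omega> \<kappa> (\<theta> t) $ j)) (at t)"
  unfolding winfree_R_def using winfree_theta_has_derivative[OF assms]
  by (auto intro!: derivative_eq_intros simp: sum_negf sum_distrib_left)

lemma continuous_on_winfree_R: "continuous_on S winfree_R"
  by (intro continuous_at_imp_continuous_on ballI has_derivative_continuous[OF winfree_R_has_derivative])

section \<open>Trajectories whose order parameter stays below 1\<close>

text \<open>The right-hand side is the rate of change of - \<Sum> \<omega> sin \<theta> along the
  flow. Where R is small, every cosine is close to -1 and the field is close to \<omega>, so this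
  rate is nearly \<open>W\<close>; both deviations are linear in R, the first by
  \<open>one_plus_cos_le_winfree_R\<close>.\<close>

lemma winfree_drift:
  fixes x \<omega> :: "real^'n"
  assumes \<kappa>: "0 \<le> \<kappa>"
  defines "W \<equiv> \<Sum>i\<in>UNIV. (\<omega> $ i)\<^sup>2" and "V \<equiv> \<Sum>i\<in>UNIV. \<bar>\<omega> $ i\<bar>"
  shows "W - winfree_R x * (real CARD('n) * W + \<kappa> * V)
     \<le> - (\<Sum>i\<in>UNIV. \<omega> $ i * (winfree_field \<omega> \<kappa> x $ i * cos (x $ i)))"
proof -
  let ?R = "winfree_R x" and ?N = "real CARD('n)"
  have "(\<omega> $ i)\<^sup>2 - ?R * (?N * (\<omega> $ i)\<^sup>2 + \<kappa> * \<bar>\<omega> $ i\<bar>)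
      \<le> - (\<omega> $ i * (winfree_field \<omega> \<kappa> x $ i * cos (x $ i)))" for i
  proof -
    have "(\<omega> $ i)\<^sup>2 * (1 + cos (x $ i)) \<le> (\<omega> $ i)\<^sup>2 * (?N * ?R)"
      by (intro mult_left_mono one_plus_cos_le_winfree_R) auto
    moreover have "\<bar>\<kappa> * ?R * \<omega> $ i * (sin (x $ i) * cos (x $ i))\<bar> \<le> \<kappa> * ?R * \<bar>\<omega> $ i\<bar> * (1 * 1)"
      unfolding abs_mult using \<kappa> winfree_R_nonneg[of x]
      by (intro mult_mono mult_nonneg_nonneg) auto
    ultimately show ?thesis
      by (simp add: winfree_field_nth algebra_simps power2_eq_square abs_le_iff)
  qed
  then have "(\<Sum>i\<in>UNIV. (\<omega> $ i)\<^sup>2 - ?R * (?N * (\<omega> $ i)\<^sup>2 + \<kappa> * \<bar>\<omega> $ i\<bar>))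
      \<le> (\<Sum>i\<in>UNIV. - (\<omega> $ i * (winfree_field \<omega> \<kappa> x $ i * cos (x $ i))))"
    by (intro sum_mono)
  then show ?thesis
    by (simp add: W_def V_def sum_subtractf sum_distrib_left[symmetric] sum.distrib sum_negf)
qed

lemma cball_winfree_R:
  assumes "y \<in> cball x \<eta>"
  shows "winfree_R x - \<eta> \<le> winfree_R y" "winfree_R y \<le> winfree_R x + \<eta>"
  using assms winfree_R_lipschitz[of x y] by (auto simp: dist_norm)

text \<open>Near \<open>R = 0\<close> the divergence of the field degenerates; there the correction
  \<open>g = - \<epsilon> \<Sum> \<omega>\<^sub>i sin \<theta>\<^sub>i\<close> grows along the flow because the oscillators drift away from \<open>\<pi>\<close>.\<close>

lemma negligible_winfree_low_R_nonzero:
  fixes \<omega> :: "real^'n::{finite,wellorder}"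
  assumes \<kappa>: "0 < \<kappa>" and \<rho>: "\<rho> < 1" and \<omega>: "\<omega> \<noteq> 0"
  shows "negligible {\<theta> 0 |\<theta>. ode_solution (winfree_field \<omega> \<kappa>) \<theta> \<and> (\<forall>t\<ge>0. winfree_R (\<theta> t) \<le> \<rho>)}"
proof -
  define N where "N = real CARD('n)"
  define W where "W = (\<Sum>i\<in>UNIV. (\<omega> $ i)\<^sup>2)"
  define V where "V = (\<Sum>i\<in>UNIV. \<bar>\<omega> $ i\<bar>)"
  define \<eta> where "\<eta> = (1 - \<rho>) / 2"
  \<comment> \<open>On \<open>Q\<close> the divergence is at least \<kappa> N R \<eta>. This choice
    makes the loss \<epsilon> R (N W + \<kappa> V) from \<open>winfree_drift\<close> equal to
    exactly that amount, so the rate \<open>\<epsilon> * W\<close> remains for every value of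
    R.\<close>
  define \<epsilon> where "\<epsilon> = \<kappa> * N * \<eta> / (N * W + \<kappa> * V)"
  define C where "C = V + 2 * \<kappa> * N"
  define Q :: "(real^'n::_) set" where "Q = {x. winfree_R x \<le> \<rho> + \<eta>}"
  define g where "g x = - \<epsilon> * (\<Sum>i\<in>UNIV. \<omega> $ i * sin (x $ i))" for x :: "real^'n::_"
  have N: "0 < N" by (simp add: N_def)
  have \<eta>: "0 < \<eta>" "1 - (\<rho> + \<eta>) = \<eta>" using \<rho> by (auto simp: \<eta>_def field_simps)
  obtain k where k: "\<omega> $ k \<noteq> 0" using \<omega> by (auto simp: vec_eq_iff)
  have "(\<omega> $ k)\<^sup>2 \<le> W" "\<bar>\<omega> $ k\<bar> \<le> V" unfolding W_def V_def by (auto intro!: member_le_sum)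
  then have W: "0 < W" and V: "0 < V" using k zero_less_power2[of "\<omega> $ k"] by (linarith, linarith)
  have D: "0 < N * W + \<kappa> * V" using N W \<kappa> V by (simp add: add_pos_pos)
  have \<epsilon>: "0 < \<epsilon>" "\<epsilon> * (N * W + \<kappa> * V) = \<kappa> * N * \<eta>"
    using D \<kappa> N \<eta> by (auto simp: \<epsilon>_def)
  have C: "0 < C" using V \<kappa> N by (simp add: C_def add_pos_pos)
  have bd: "norm (winfree_field \<omega> \<kappa> x) \<le> C" for x
    unfolding C_def V_def N_def using \<kappa> by (intro winfree_field_bounded) simp
  have "negligible {\<theta> 0 |\<theta>. ode_solution (winfree_field \<omega> \<kappa>) \<theta> \<and> (\<forall>t\<ge>0. cball (\<theta> t) \<eta> \<subseteq> Q)}"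
  proof (rule negligible_expanding_trajectories[OF winfree_field_has_derivative winfree_field_lipschitz _ bd C
        winfree_jac_bounded, where g = g and G = "\<epsilon> * V" and c = "\<epsilon> * W" and K = "\<epsilon> * V * C\<^sup>2"])
    show "closed Q"
      unfolding Q_def by (intro closed_Collect_le continuous_on_winfree_R continuous_on_const)
    show "\<bar>g x\<bar> \<le> \<epsilon> * V" for x
    proof -
      have "\<bar>\<Sum>i\<in>UNIV. \<omega> $ i * sin (x $ i)\<bar> \<le> (\<Sum>i\<in>UNIV. \<bar>\<omega> $ i\<bar> * 1)"
        by (intro order_trans[OF sum_abs] sum_mono) (auto simp: abs_mult intro!: mult_left_le)
      then show ?thesis using \<epsilon> by (simp add: g_def V_def abs_mult)
    qed
    fix x :: "real^'n::_" and h :: real assume x: "x \<in> Q" and h: "0 \<le> h"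
    let ?F = "winfree_field \<omega> \<kappa> x"
    have "\<omega> $ i * sin (euler_step (winfree_field \<omega> \<kappa>) h x $ i) - \<omega> $ i * sin (x $ i)
        \<le> h * (\<omega> $ i * (?F $ i * cos (x $ i))) + \<bar>\<omega> $ i\<bar> * (C\<^sup>2 * h\<^sup>2)" for i
    proof -
      have "\<bar>?F $ i\<bar> \<le> C" using component_le_norm_cart[of ?F i] bd[of x] by linarith
      then have "(?F $ i)\<^sup>2 \<le> C\<^sup>2" using C by (simp add: abs_le_square_iff[symmetric])
      then have "(h * ?F $ i)\<^sup>2 \<le> C\<^sup>2 * h\<^sup>2"
        by (simp add: power_mult_distrib mult.commute[of "h\<^sup>2"] mult_right_mono)
      then have "\<bar>sin (x $ i + h * ?F $ i) - sin (x $ i) - h * ?F $ i * cos (x $ i)\<bar> \<le> C\<^sup>2 * h\<^sup>2"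
        using sin_add_linear_error[of "x $ i" "h * ?F $ i"] by linarith
      then have "\<bar>\<omega> $ i\<bar> * \<bar>sin (x $ i + h * ?F $ i) - sin (x $ i) - h * ?F $ i * cos (x $ i)\<bar>
          \<le> \<bar>\<omega> $ i\<bar> * (C\<^sup>2 * h\<^sup>2)"
        by (intro mult_left_mono) auto
      then have "\<omega> $ i * (sin (x $ i + h * ?F $ i) - sin (x $ i) - h * ?F $ i * cos (x $ i))
          \<le> \<bar>\<omega> $ i\<bar> * (C\<^sup>2 * h\<^sup>2)"
        unfolding abs_mult[symmetric] by linarith
      then show ?thesis by (simp add: euler_step_def algebra_simps)
    qed
    then have "(\<Sum>i\<in>UNIV. \<omega> $ i * sin (euler_step (winfree_field \<omega> \<kappa>) h x $ i) - \<omega> $ i * sin (x $ i))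
        \<le> (\<Sum>i\<in>UNIV. h * (\<omega> $ i * (?F $ i * cos (x $ i))) + \<bar>\<omega> $ i\<bar> * (C\<^sup>2 * h\<^sup>2))"
      by (intro sum_mono)
    then have 1: "(\<Sum>i\<in>UNIV. \<omega> $ i * sin (euler_step (winfree_field \<omega> \<kappa>) h x $ i)) - (\<Sum>i\<in>UNIV. \<omega> $ i * sin (x $ i))
        \<le> h * (\<Sum>i\<in>UNIV. \<omega> $ i * (?F $ i * cos (x $ i))) + V * (C\<^sup>2 * h\<^sup>2)"
      by (simp add: sum_subtractf sum.distrib sum_distrib_left[symmetric] sum_distrib_right[symmetric] V_def)
    have "W - winfree_R x * (N * W + \<kappa> * V) \<le> - (\<Sum>i\<in>UNIV. \<omega> $ i * (?F $ i * cos (x $ i)))"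
      unfolding W_def V_def N_def using \<kappa> by (intro winfree_drift) auto
    then have "h * (\<Sum>i\<in>UNIV. \<omega> $ i * (?F $ i * cos (x $ i))) \<le> h * (winfree_R x * (N * W + \<kappa> * V) - W)"
      using h by (intro mult_left_mono) auto
    with 1 have "(\<Sum>i\<in>UNIV. \<omega> $ i * sin (euler_step (winfree_field \<omega> \<kappa>) h x $ i)) - (\<Sum>i\<in>UNIV. \<omega> $ i * sin (x $ i))
        \<le> h * (winfree_R x * (N * W + \<kappa> * V) - W) + V * (C\<^sup>2 * h\<^sup>2)" by linarith
    then have "\<epsilon> * ((\<Sum>i\<in>UNIV. \<omega> $ i * sin (euler_step (winfree_field \<omega> \<kappa>) h x $ i)) - (\<Sum>i\<in>UNIV. \<omega> $ i * sin (x $ i)))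
        \<le> \<epsilon> * (h * (winfree_R x * (N * W + \<kappa> * V) - W) + V * (C\<^sup>2 * h\<^sup>2))"
      using \<epsilon> by (intro mult_left_mono) auto
    then have 2: "g x - g (euler_step (winfree_field \<omega> \<kappa>) h x)
        \<le> h * winfree_R x * (\<epsilon> * (N * W + \<kappa> * V)) - \<epsilon> * W * h + \<epsilon> * V * C\<^sup>2 * h\<^sup>2"
      by (simp add: g_def algebra_simps)
    have "\<eta> \<le> 1 - winfree_R x" using x \<eta>(2) by (simp add: Q_def)
    then have "\<kappa> * N * winfree_R x * \<eta> \<le> \<kappa> * N * winfree_R x * (1 - winfree_R x)"
      using \<kappa> N winfree_R_nonneg[of x] by (intro mult_left_mono) auto
    also have "\<dots> \<le> trace (winfree_jac \<kappa> x)"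
      unfolding N_def using \<kappa> by (intro trace_winfree_jac_ge) simp
    finally have "h * (\<kappa> * N * winfree_R x * \<eta>) \<le> h * trace (winfree_jac \<kappa> x)"
      using h by (intro mult_left_mono)
    then show "\<epsilon> * W * h - \<epsilon> * V * C\<^sup>2 * h\<^sup>2
        \<le> g (euler_step (winfree_field \<omega> \<kappa>) h x) - g x + h * trace (winfree_jac \<kappa> x)"
      using 2 unfolding \<epsilon>(2) by (simp add: mult_ac)
  qed (use \<kappa> \<epsilon> W V \<eta> in auto)
  then show ?thesis
  proof (rule negligible_subset)
    have "cball (\<theta> t) \<eta> \<subseteq> Q" if "winfree_R (\<theta> t) \<le> \<rho>" for \<theta> :: "real \<Rightarrow> real^'n::_" and t
      using that cball_winfree_R(2)[of _ "\<theta> t" \<eta>] by (force simp: Q_def)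
    then show "{\<theta> 0 |\<theta>. ode_solution (winfree_field \<omega> \<kappa>) \<theta> \<and> (\<forall>t\<ge>0. winfree_R (\<theta> t) \<le> \<rho>)}
      \<subseteq> {\<theta> 0 |\<theta>. ode_solution (winfree_field \<omega> \<kappa>) \<theta> \<and> (\<forall>t\<ge>0. cball (\<theta> t) \<eta> \<subseteq> Q)}"
      by blast
  qed
qed

text \<open>Away from both R = 0 and R = 1 the divergence itself has a positive lower bound, so the
  correction can be taken as 0. This serves the case \<open>\<omega> = 0\<close>, where there is no
  drift away from \<pi> to exploit.\<close>

lemma negligible_winfree_band:
  fixes \<omega> :: "real^'n::{finite,wellorder}"
  assumes \<kappa>: "0 < \<kappa>" and \<rho>: "\<rho> < 1" and \<delta>: "0 < \<delta>"
  shows "negligible {\<theta> 0 |\<theta>. ode_solution (winfree_field \<omega> \<kappa>) \<theta> \<and>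
     (\<forall>t\<ge>0. \<delta> \<le> winfree_R (\<theta> t) \<and> winfree_R (\<theta> t) \<le> \<rho>)}"
proof -
  define N where "N = real CARD('n)"
  define \<eta> where "\<eta> = min (\<delta> / 2) ((1 - \<rho>) / 2)"
  define C where "C = (\<Sum>i\<in>UNIV. \<bar>\<omega> $ i\<bar>) + 2 * \<kappa> * N"
  define Q :: "(real^'n::_) set" where "Q = {x. \<eta> \<le> winfree_R x} \<inter> {x. winfree_R x \<le> 1 - \<eta>}"
  have N: "0 < N" by (simp add: N_def)
  have \<eta>: "0 < \<eta>" "\<eta> \<le> \<delta> - \<eta>" "\<rho> + \<eta> \<le> 1 - \<eta>"
    using \<rho> \<delta> by (auto simp: \<eta>_def min_def field_simps)
  have C: "0 < C" unfolding C_def using \<kappa> N by (simp add: sum_nonneg add_nonneg_pos)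
  have bd: "norm (winfree_field \<omega> \<kappa> x) \<le> C" for x
    unfolding C_def N_def using \<kappa> by (intro winfree_field_bounded) simp
  have "negligible {\<theta> 0 |\<theta>. ode_solution (winfree_field \<omega> \<kappa>) \<theta> \<and> (\<forall>t\<ge>0. cball (\<theta> t) \<eta> \<subseteq> Q)}"
  proof (rule negligible_expanding_trajectories[OF winfree_field_has_derivative winfree_field_lipschitz _ bd C
        winfree_jac_bounded, where g = "\<lambda>_. 0" and G = 0 and c = "\<kappa> * N * \<eta> * \<eta>" and K = 0])
    show "closed Q"
      unfolding Q_def by (intro closed_Int closed_Collect_le continuous_on_winfree_R continuous_on_const)
    fix x :: "real^'n::_" and h :: real assume x: "x \<in> Q" and h: "0 \<le> h"
    have "\<kappa> * N * \<eta> * \<eta> \<le> \<kappa> * N * winfree_R x * (1 - winfree_R x)"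
      using \<kappa> N x \<eta> by (intro mult_mono) (auto simp: Q_def winfree_R_nonneg)
    also have "\<dots> \<le> trace (winfree_jac \<kappa> x)"
      unfolding N_def using \<kappa> by (intro trace_winfree_jac_ge) simp
    finally show "\<kappa> * N * \<eta> * \<eta> * h - 0 * h\<^sup>2 \<le> 0 - 0 + h * trace (winfree_jac \<kappa> x)"
      using h by (simp add: mult.commute[of h] mult_right_mono)
  qed (use \<kappa> \<eta> N in auto)
  then show ?thesis
  proof (rule negligible_subset)
    have "cball (\<theta> t) \<eta> \<subseteq> Q" if "\<delta> \<le> winfree_R (\<theta> t)" "winfree_R (\<theta> t) \<le> \<rho>"
      for \<theta> :: "real \<Rightarrow> real^'n::_" and t
      using that cball_winfree_R[of _ "\<theta> t" \<eta>] \<eta> by (force simp: Q_def)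
    then show "{\<theta> 0 |\<theta>. ode_solution (winfree_field \<omega> \<kappa>) \<theta> \<and>
         (\<forall>t\<ge>0. \<delta> \<le> winfree_R (\<theta> t) \<and> winfree_R (\<theta> t) \<le> \<rho>)}
      \<subseteq> {\<theta> 0 |\<theta>. ode_solution (winfree_field \<omega> \<kappa>) \<theta> \<and> (\<forall>t\<ge>0. cball (\<theta> t) \<eta> \<subseteq> Q)}"
      by blast
  qed
qed

text \<open>With zero frequencies the derivative of R is \<kappa> R / N times the sum of the squared
  sines.\<close>

lemma winfree_R_mono_zero_frequency:
  assumes sol: "ode_solution (winfree_field 0 \<kappa>) \<theta>" and "0 \<le> \<kappa>" "0 \<le> t"
  shows "winfree_R (\<theta> 0) \<le> winfree_R (\<theta> t)"
proof (rule DERIV_nonneg_imp_increasing_open[where f = "\<lambda>t. winfree_R (\<theta> t)"])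
  show "continuous_on {0..t} (\<lambda>t. winfree_R (\<theta> t))"
    by (rule continuous_on_compose2[OF continuous_on_winfree_R[of UNIV] ode_solution_continuous_on[OF sol]]) auto
  fix s assume s: "0 < s" "s < t"
  let ?d = "- (1 / real CARD('a)) * (\<Sum>j\<in>UNIV. sin (\<theta> s $ j) * winfree_field 0 \<kappa> (\<theta> s) $ j)"
  have "(\<Sum>j\<in>UNIV. sin (\<theta> s $ j) * winfree_field 0 \<kappa> (\<theta> s) $ j)
     = - (\<kappa> * winfree_R (\<theta> s) * (\<Sum>j\<in>UNIV. (sin (\<theta> s $ j))\<^sup>2))"
    by (simp add: winfree_field_nth sum_negf sum_distrib_left power2_eq_square mult_ac)
  moreover have "0 \<le> \<kappa> * winfree_R (\<theta> s) * (\<Sum>j\<in>UNIV. (sin (\<theta> s $ j))\<^sup>2)"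
    using assms winfree_R_nonneg by (intro mult_nonneg_nonneg sum_nonneg) auto
  ultimately have "0 \<le> ?d" by simp
  then show "\<exists>y. ((\<lambda>t. winfree_R (\<theta> t)) has_real_derivative y) (at s) \<and> 0 \<le> y"
    using winfree_R_has_real_derivative[OF sol s(1)] by blast
qed fact

text \<open>R is an average of nonnegative terms and vanishes only if every cosine is -1. A single
  coordinate already confines such points to countably many hyperplanes.\<close>

lemma negligible_winfree_R_eq_0: "negligible {x :: real^'n. winfree_R x = 0}"
proof -
  have "negligible {x :: real^'n. x $ undefined = a}" for a
    by (simp add: cart_eq_inner_axis negligible_standard_hyperplane)
  then have "negligible (\<Union>k::int. {x :: real^'n. x $ undefined = (2 * k + 1) * pi})"
    by (intro negligible_countable_Union) auto
  then show ?thesis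
  proof (rule negligible_subset)
    show "{x :: real^'n. winfree_R x = 0} \<subseteq> (\<Union>k::int. {x. x $ undefined = (2 * k + 1) * pi})"
    proof clarify
      fix x :: "real^'n" assume "winfree_R x = 0"
      then have "cos (x $ undefined) = -1"
        using one_plus_cos_le_winfree_R[of x undefined] one_plus_cos_nonneg[of "x $ undefined"] by simp
      then show "x \<in> (\<Union>k::int. {x. x $ undefined = (2 * k + 1) * pi})"
        by (auto simp: cos_eq_minus1)
    qed
  qed
qed

text \<open>For \<open>\<omega> = 0\<close>, monotonicity of R keeps a trajectory with R > 0 at the
  start above some \<open>1 / real (Suc m)\<close>, hence in one of countably many bands; starting
  points with R = 0 form a null set.\<close>

lemma negligible_winfree_low_R_wellorder:
  fixes \<omega> :: "real^'n::{finite,wellorder}"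
  assumes \<kappa>: "0 < \<kappa>" and \<rho>: "\<rho> < 1"
  shows "negligible {\<theta> 0 |\<theta>. ode_solution (winfree_field \<omega> \<kappa>) \<theta> \<and> (\<forall>t\<ge>0. winfree_R (\<theta> t) \<le> \<rho>)}"
    (is "negligible ?E")
proof (cases "\<omega> = 0")
  case True
  let ?B = "\<lambda>m::nat. {\<theta> 0 |\<theta>. ode_solution (winfree_field \<omega> \<kappa>) \<theta> \<and>
     (\<forall>t\<ge>0. 1 / real (Suc m) \<le> winfree_R (\<theta> t) \<and> winfree_R (\<theta> t) \<le> \<rho>)}"
  have "negligible ({x. winfree_R x = 0} \<union> (\<Union>m. ?B m))"
    using \<kappa> \<rho> by (intro negligible_Un negligible_winfree_R_eq_0 negligible_Union_nat negligible_winfree_band) auto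
  then show ?thesis
  proof (rule negligible_subset, intro subsetI)
    fix x assume "x \<in> ?E"
    then obtain \<theta> where \<theta>: "x = \<theta> 0" "ode_solution (winfree_field \<omega> \<kappa>) \<theta>" "\<forall>t\<ge>0. winfree_R (\<theta> t) \<le> \<rho>" by blast
    show "x \<in> {x. winfree_R x = 0} \<union> (\<Union>m. ?B m)"
    proof (cases "winfree_R x = 0")
      case False
      then obtain m where "1 / real (Suc m) < winfree_R x"
        using nat_approx_posE winfree_R_nonneg by (metis order_le_less)
      moreover have "winfree_R x \<le> winfree_R (\<theta> t)" if "0 \<le> t" for t
        using winfree_R_mono_zero_frequency[of \<kappa> \<theta> t] \<theta> True \<kappa> that by simp
      ultimately have "x \<in> ?B m" using \<theta> by fastforce
      then show ?thesis by blast
    qed simp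
  qed
next
  case False
  then show ?thesis by (rule negligible_winfree_low_R_nonzero[OF assms])
qed

section \<open>Transport to arbitrary finite index types\<close>

definition to_widx_vec :: "real^'n \<Rightarrow> real^'n widx" where
  "to_widx_vec x = (\<chi> i. x $ of_widx i)"

definition of_widx_vec :: "real^'n widx \<Rightarrow> real^'n" where
  "of_widx_vec x = (\<chi> i. x $ to_widx i)"

lemma of_widx_vec_inverse: "of_widx_vec (to_widx_vec x) = x"
  by (simp add: of_widx_vec_def to_widx_vec_def vec_eq_iff to_widx_inverse)

lemma card_widx: "CARD('n widx) = CARD('n)"
  using bij_of_widx bij_betw_same_card by blast

lemma winfree_R_to_widx_vec: "winfree_R (to_widx_vec x) = winfree_R x"
  unfolding winfree_R_def card_widx to_widx_vec_def
  using sum.reindex_bij_betw[OF bij_of_widx, of "\<lambda>i. 1 + cos (x $ i)"] by simp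

lemma winfree_field_to_widx_vec:
  "winfree_field (to_widx_vec \<omega>) \<kappa> (to_widx_vec x) = to_widx_vec (winfree_field \<omega> \<kappa> x)"
  by (simp add: vec_eq_iff winfree_field_nth winfree_R_to_widx_vec) (simp add: to_widx_vec_def winfree_field_nth)

lemma ode_solution_to_widx_vec:
  assumes "ode_solution (winfree_field \<omega> \<kappa>) \<theta>"
  shows "ode_solution (winfree_field (to_widx_vec \<omega>) \<kappa>) (\<lambda>t. to_widx_vec (\<theta> t))"
proof -
  have "linear (to_widx_vec :: real^'a \<Rightarrow> _)"
    by (rule linearI) (simp_all add: to_widx_vec_def vec_eq_iff)
  then have bl: "bounded_linear (to_widx_vec :: real^'a \<Rightarrow> _)"
    by (simp add: linear_conv_bounded_linear)
  show ?thesis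
    unfolding ode_solution_def winfree_field_to_widx_vec
  proof (intro conjI allI impI)
    show "continuous_on {0..} (\<lambda>t. to_widx_vec (\<theta> t))"
      using assms unfolding ode_solution_def by (intro bounded_linear.continuous_on[OF bl]) auto
    fix t :: real assume "0 < t"
    then show "((\<lambda>t. to_widx_vec (\<theta> t)) has_vector_derivative to_widx_vec (winfree_field \<omega> \<kappa> (\<theta> t))) (at t)"
      using assms unfolding ode_solution_def by (intro bounded_linear.has_vector_derivative[OF bl]) auto
  qed
qed

text \<open>Reindexing carries solutions to solutions and preserves R. The inverse reindexing is
  linear between spaces of equal dimension, so it sends null sets to null sets.\<close>

lemma negligible_winfree_low_R:
  fixes \<omega> :: "real^'n"
  assumes "0 < \<kappa>" "\<rho> < 1"
  shows "negligible {\<theta> 0 |\<theta>. ode_solution (winfree_field \<omega> \<kappa>) \<theta> \<and> (\<forall>t\<ge>0. winfree_R (\<theta> t) \<le> \<rho>)}"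
proof -
  let ?E = "{\<theta> 0 |\<theta>. ode_solution (winfree_field (to_widx_vec \<omega>) \<kappa>) \<theta> \<and> (\<forall>t\<ge>0. winfree_R (\<theta> t) \<le> \<rho>)}"
  have "linear (of_widx_vec :: _ \<Rightarrow> real^'n)"
    by (rule linearI) (simp_all add: of_widx_vec_def vec_eq_iff)
  then have "of_widx_vec differentiable_on ?E"
    by (rule linear_imp_differentiable_on)
  then have "negligible (of_widx_vec ` ?E)"
    by (intro negligible_differentiable_image_negligible negligible_winfree_low_R_wellorder assms)
       (simp_all add: card_widx)
  then show ?thesis
  proof (rule negligible_subset, clarify)
    fix \<theta> assume \<theta>: "ode_solution (winfree_field \<omega> \<kappa>) \<theta>" "\<forall>t\<ge>0. winfree_R (\<theta> t) \<le> \<rho>"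
    have "to_widx_vec (\<theta> 0) \<in> ?E"
      using ode_solution_to_widx_vec[OF \<theta>(1)] \<theta>(2) by (auto simp: winfree_R_to_widx_vec)
    with of_widx_vec_inverse[symmetric] show "\<theta> 0 \<in> of_widx_vec ` ?E"
      by (rule image_eqI)
  qed
qed

section \<open>Convergence of the order parameter\<close>

text \<open>If all velocities vanish, then \<open>sin \<theta>\<^sub>i = \<omega>\<^sub>i / (\<kappa> R)\<close>, and \<open>R\<close> is a zero of one of the following functions,
  where \<open>A\<close> is the set of oscillators with nonnegative cosine.\<close>

definition winfree_balance :: "real^'n \<Rightarrow> real \<Rightarrow> 'n set \<Rightarrow> real \<Rightarrow> real" where
  "winfree_balance \<omega> \<kappa> A r = r - 1 -
     (1 / real CARD('n)) * (\<Sum>i\<in>UNIV. (if i \<in> A then 1 else -1) * sqrt (1 - (\<omega> $ i / (\<kappa> * r))\<^sup>2))"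

lemma abs_signed_sqrt_avg_le_1:
  fixes u :: "'n::finite \<Rightarrow> real"
  assumes "\<And>i. \<bar>u i\<bar> \<le> 1"
  shows "\<bar>(1 / real CARD('n)) * (\<Sum>i\<in>UNIV. (if i \<in> A then 1 else -1) * sqrt (1 - (u i)\<^sup>2))\<bar> \<le> 1"
proof -
  have "\<bar>(if i \<in> A then 1 else -1) * sqrt (1 - (u i)\<^sup>2)\<bar> \<le> 1" for i
    using assms[of i] by (simp add: abs_mult abs_square_le_1)
  then have "\<bar>\<Sum>i\<in>UNIV. (if i \<in> A then 1 else -1) * sqrt (1 - (u i)\<^sup>2)\<bar> \<le> (\<Sum>i\<in>(UNIV :: 'n set). 1)"
    by (intro order_trans[OF sum_abs] sum_mono)
  then show ?thesis by (simp add: abs_mult field_simps)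
qed

text \<open>Identity theorem: a product vanishing on an interval would vanish on the half-plane
  \<open>Re z > q\<close>, where \<open>\<bar>\<omega> $ i\<bar> < \<kappa> * norm z\<close> keeps
  the radicands off the branch cut. At 3, however, \<open>r - 1 = 2\<close>, while the signed
  average of the roots is at most 1, so no factor vanishes.\<close>

lemma prod_winfree_balance_not_0:
  fixes \<omega> :: "real^'n"
  assumes \<kappa>: "0 < \<kappa>" and q: "0 \<le> q" "q < 3" "\<And>i. \<bar>\<omega> $ i\<bar> \<le> \<kappa> * q" and xy: "q \<le> x" "x < y"
  shows "\<exists>r. x < r \<and> r < y \<and> (\<Prod>A\<in>UNIV. winfree_balance \<omega> \<kappa> A r) \<noteq> 0"
proof (rule ccontr)
  assume "\<not> ?thesis"
  then have zero: "(\<Prod>A\<in>UNIV. winfree_balance \<omega> \<kappa> A r) = 0" if "x < r" "r < y" for r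
    using that by blast
  define f where "f z = (\<Prod>A\<in>(UNIV :: 'n set set). z - 1 - (1 / of_nat CARD('n)) *
      (\<Sum>i\<in>UNIV. (if i \<in> A then 1 else -1) * csqrt (1 - (of_real (\<omega> $ i) / (of_real \<kappa> * z))\<^sup>2)))" for z
  define S where "S = {z. q < Re z}"
  obtain m where m: "x < m" "m < y" using dense xy(2) by blast
  have small: "norm (of_real (\<omega> $ i) / (of_real \<kappa> * z)) < 1" if "z \<in> S" for z i
  proof -
    have "\<kappa> * q < \<kappa> * norm z"
      using that \<kappa> complex_Re_le_cmod[of z] by (intro mult_strict_left_mono) (auto simp: S_def)
    then have "\<bar>\<omega> $ i\<bar> < \<kappa> * norm z" using q(3)[of i] by linarith
    then show ?thesis using \<kappa> by (simp add: norm_divide norm_mult divide_less_eq)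
  qed
  have f_of_real: "f (of_real r) = of_real (\<Prod>A\<in>UNIV. winfree_balance \<omega> \<kappa> A r)" if "q < r" for r
  proof -
    have "csqrt (1 - (of_real (\<omega> $ i) / (of_real \<kappa> * of_real r))\<^sup>2) = of_real (sqrt (1 - (\<omega> $ i / (\<kappa> * r))\<^sup>2))" for i
    proof -
      have "\<bar>\<omega> $ i / (\<kappa> * r)\<bar> < 1"
        using small[of "of_real r" i] that by (simp add: S_def norm_divide norm_mult abs_mult)
      then have "0 \<le> 1 - (\<omega> $ i / (\<kappa> * r))\<^sup>2" by (simp add: abs_square_le_1)
      from of_real_sqrt[OF this] show ?thesis by simp
    qed
    then show ?thesis
      unfolding f_def winfree_balance_def
      by (simp add: if_distrib[of complex_of_real] cong: if_cong)
  qed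
  have "f holomorphic_on S"
    unfolding f_def
  proof (intro holomorphic_intros)
    fix z i assume z: "z \<in> S"
    show "of_real \<kappa> * z \<noteq> 0" using z \<kappa> q by (auto simp: S_def)
    have "norm ((of_real (\<omega> $ i) / (of_real \<kappa> * z))\<^sup>2) < 1"
      using small[OF z, of i] by (simp add: norm_power power_less_one_iff)
    then have "Re ((of_real (\<omega> $ i) / (of_real \<kappa> * z))\<^sup>2) < 1"
      using complex_Re_le_cmod order_le_less_trans by blast
    then show "1 - (of_real (\<omega> $ i) / (of_real \<kappa> * z))\<^sup>2 \<notin> \<real>\<^sub>\<le>\<^sub>0"
      by (auto simp: complex_nonpos_Reals_iff)
  qed
  moreover have "open S" "connected S"
    unfolding S_def by (auto intro: open_halfspace_Re_gt convex_connected convex_halfspace_Re_gt)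
  moreover have "of_real ` {x<..<y} \<subseteq> S" using xy by (auto simp: S_def)
  moreover have "of_real m \<in> S" using xy m by (auto simp: S_def)
  moreover have "(of_real m :: complex) islimpt of_real ` {x<..<y}"
  proof (unfold islimpt_approachable, intro allI impI)
    fix e :: real assume e: "0 < e"
    define d where "d = min (e / 2) ((y - m) / 2)"
    have d: "0 < d" "d < e" "x < m + d" "m + d < y"
      using e m by (auto simp: d_def min_def field_simps)
    have "dist (of_real (m + d) :: complex) (of_real m) = d"
      unfolding dist_of_real using d by (simp add: dist_real_def)
    then show "\<exists>x'\<in>of_real ` {x<..<y}. x' \<noteq> (of_real m :: complex) \<and> dist x' (of_real m) < e"
      using d by (intro bexI[of _ "of_real (m + d)"]) (auto simp del: of_real_add)
  qed
  moreover have "f z = 0" if "z \<in> of_real ` {x<..<y}" for z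
    using that zero f_of_real xy by auto
  moreover have "of_real 3 \<in> S" using q by (simp add: S_def)
  ultimately have "f (of_real 3) = 0" by (rule analytic_continuation)
  then have "(\<Prod>A\<in>UNIV. winfree_balance \<omega> \<kappa> A 3) = 0"
    using f_of_real[of 3] q by simp
  then obtain A where A: "winfree_balance \<omega> \<kappa> A 3 = 0" by auto
  have "\<bar>\<omega> $ i / (\<kappa> * 3)\<bar> \<le> 1" for i
  proof -
    have "\<kappa> * q \<le> \<kappa> * 3" using q \<kappa> by (intro mult_left_mono) auto
    then have "\<bar>\<omega> $ i\<bar> \<le> \<kappa> * 3" using q(3)[of i] by linarith
    then show ?thesis using \<kappa> by (simp add: divide_le_eq)
  qed
  from abs_signed_sqrt_avg_le_1[of "\<lambda>i. \<omega> $ i / (\<kappa> * 3)" A, OF this]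
  show False using A unfolding winfree_balance_def by linarith
qed

lemma abs_sqrt_diff_le:
  fixes a b :: real
  assumes "0 \<le> a" "0 \<le> b"
  shows "\<bar>sqrt a - sqrt b\<bar> \<le> sqrt \<bar>a - b\<bar>"
proof (cases "a \<le> b")
  case True
  then show ?thesis using sqrt_add_le_add_sqrt[of a "b - a"] assms by simp
next
  case False
  then show ?thesis using sqrt_add_le_add_sqrt[of b "a - b"] assms by simp
qed

text \<open>Each cosine is its sign times the root of 1 - sin^2, and replacing the sine by \<omega>
  / (\<kappa> R) changes the radicand by a multiple of the velocity. Radicands may come close to 0,
  where the root is only Hoelder continuous of order 1/2; hence the square roots of the velocities.
  The crude bound 2 is meant for the remaining factors of the product.\<close>

lemma abs_winfree_balance_le:
  fixes x :: "real^'n"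
  assumes \<kappa>: "0 < \<kappa>" and \<rho>: "0 < \<rho>" "\<rho> \<le> winfree_R x" and \<omega>: "\<And>i. \<bar>\<omega> $ i\<bar> \<le> \<kappa> * \<rho>"
  shows "\<bar>winfree_balance \<omega> \<kappa> A (winfree_R x)\<bar> \<le> 2"
    and "\<bar>winfree_balance \<omega> \<kappa> {i. 0 \<le> cos (x $ i)} (winfree_R x)\<bar>
      \<le> (1 / real CARD('n)) * (\<Sum>i\<in>UNIV. sqrt (2 * \<bar>winfree_field \<omega> \<kappa> x $ i\<bar> / (\<kappa> * \<rho>)))"
proof -
  let ?R = "winfree_R x" and ?y = "\<lambda>i. \<omega> $ i / (\<kappa> * winfree_R x)"
  have kR: "0 < \<kappa> * \<rho>" "\<kappa> * \<rho> \<le> \<kappa> * ?R" using \<kappa> \<rho> by auto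
  have y1: "\<bar>?y i\<bar> \<le> 1" for i
  proof -
    have "0 < \<kappa> * ?R" using kR by linarith
    then show ?thesis using \<omega>[of i] kR by (simp only: abs_divide abs_of_pos divide_le_eq if_True)
  qed
  show "\<bar>winfree_balance \<omega> \<kappa> A ?R\<bar> \<le> 2"
    using abs_signed_sqrt_avg_le_1[of ?y A, OF y1] winfree_R_nonneg[of x] winfree_R_le_2[of x]
    unfolding winfree_balance_def by linarith
  let ?s = "\<lambda>i. if i \<in> {i. 0 \<le> cos (x $ i)} then 1 else - 1 :: real"
  have "\<bar>cos (x $ i) - ?s i * sqrt (1 - (?y i)\<^sup>2)\<bar> \<le> sqrt (2 * \<bar>winfree_field \<omega> \<kappa> x $ i\<bar> / (\<kappa> * \<rho>))" for i
  proof -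
    have "cos (x $ i) = ?s i * sqrt (1 - (sin (x $ i))\<^sup>2)"
      by (simp add: cos_squared_eq[symmetric])
    then have "\<bar>cos (x $ i) - ?s i * sqrt (1 - (?y i)\<^sup>2)\<bar> = \<bar>?s i * (sqrt (1 - (sin (x $ i))\<^sup>2) - sqrt (1 - (?y i)\<^sup>2))\<bar>"
      by (simp only: right_diff_distrib)
    also have "\<dots> = \<bar>sqrt (1 - (sin (x $ i))\<^sup>2) - sqrt (1 - (?y i)\<^sup>2)\<bar>"
      by (simp add: abs_mult)
    also have "\<dots> \<le> sqrt \<bar>(1 - (sin (x $ i))\<^sup>2) - (1 - (?y i)\<^sup>2)\<bar>"
      using y1[of i] by (intro abs_sqrt_diff_le) (auto simp: abs_square_le_1)
    also have "\<dots> \<le> sqrt (2 * \<bar>winfree_field \<omega> \<kappa> x $ i\<bar> / (\<kappa> * \<rho>))"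
    proof (rule real_sqrt_le_mono)
      have "\<bar>(1 - (sin (x $ i))\<^sup>2) - (1 - (?y i)\<^sup>2)\<bar> = \<bar>?y i + sin (x $ i)\<bar> * \<bar>?y i - sin (x $ i)\<bar>"
        by (simp add: abs_mult[symmetric] power2_eq_square algebra_simps)
      also have "\<dots> \<le> 2 * \<bar>?y i - sin (x $ i)\<bar>"
        using y1[of i] abs_sin_le_one[of "x $ i"] by (intro mult_right_mono) linarith+
      also have "?y i - sin (x $ i) = winfree_field \<omega> \<kappa> x $ i / (\<kappa> * ?R)"
        using kR \<kappa> \<rho> by (simp add: winfree_field_nth field_simps)
      also have "2 * \<bar>winfree_field \<omega> \<kappa> x $ i / (\<kappa> * ?R)\<bar> \<le> 2 * \<bar>winfree_field \<omega> \<kappa> x $ i\<bar> / (\<kappa> * \<rho>)"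
        using kR by (simp add: abs_divide frac_le)
      finally show "\<bar>(1 - (sin (x $ i))\<^sup>2) - (1 - (?y i)\<^sup>2)\<bar> \<le> 2 * \<bar>winfree_field \<omega> \<kappa> x $ i\<bar> / (\<kappa> * \<rho>)" .
    qed
    finally show ?thesis .
  qed
  then have "\<bar>\<Sum>i\<in>UNIV. cos (x $ i) - ?s i * sqrt (1 - (?y i)\<^sup>2)\<bar>
      \<le> (\<Sum>i\<in>UNIV. sqrt (2 * \<bar>winfree_field \<omega> \<kappa> x $ i\<bar> / (\<kappa> * \<rho>)))"
    by (intro order_trans[OF sum_abs] sum_mono)
  moreover have "winfree_balance \<omega> \<kappa> {i. 0 \<le> cos (x $ i)} ?R =
      (1 / real CARD('n)) * (\<Sum>i\<in>UNIV. cos (x $ i) - ?s i * sqrt (1 - (?y i)\<^sup>2))"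
    unfolding winfree_balance_def sum_subtractf sum_cos_eq_winfree_R by (simp add: right_diff_distrib)
  ultimately show "\<bar>winfree_balance \<omega> \<kappa> {i. 0 \<le> cos (x $ i)} ?R\<bar>
      \<le> (1 / real CARD('n)) * (\<Sum>i\<in>UNIV. sqrt (2 * \<bar>winfree_field \<omega> \<kappa> x $ i\<bar> / (\<kappa> * \<rho>)))"
    by (simp add: abs_mult divide_right_mono)
qed

section \<open>Barriers for phases and for the order parameter\<close>

text \<open>At depth v below a point \<open>p\<close> with sine -1 the sine is - cos v. Since
  \<open>r0 * cos d = \<bar>w\<bar>\<close>, the derivative is nonnegative for v between 0 and
  \<open>d\<close>, a band that \<open>u\<close> cannot cross downwards. The point \<open>p\<close>
  is taken so low that it lies below \<open>u T\<close>.\<close>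

lemma phase_bounded_below:
  fixes u r :: "real \<Rightarrow> real"
  assumes cont: "continuous_on {T..} u"
    and der: "\<And>t. T < t \<Longrightarrow> (u has_real_derivative w - r t * sin (u t)) (at t)"
    and r: "\<And>t. T < t \<Longrightarrow> r0 \<le> r t" and w: "\<bar>w\<bar> < r0"
  shows "\<exists>a. \<forall>t\<ge>T. a < u t"
proof -
  define d where "d = arccos (\<bar>w\<bar> / r0)"
  have w1: "0 \<le> \<bar>w\<bar> / r0" "\<bar>w\<bar> / r0 < 1" using w by auto
  have d: "0 < d" "d \<le> pi" "cos d = \<bar>w\<bar> / r0"
    using w1 arccos_lt_bounded[of "\<bar>w\<bar> / r0"] by (auto simp: d_def cos_arccos)
  obtain k :: nat where k: "- u T < real k" using reals_Archimedean2 by blast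
  define p where "p = - (pi / 2) - of_nat k * (2 * pi)"
  have "real k * 1 \<le> real k * (2 * pi)" using pi_gt3 by (intro mult_left_mono) auto
  then have p: "p \<le> u T" using k pi_gt_zero unfolding p_def by linarith
  have "p - d < u t" if "T \<le> t" for t
  proof (rule no_downcrossing[where s = T and t = t and b = p])
    show "continuous_on {T..t} u" using cont by (rule continuous_on_subset) auto
    fix x assume x: "T < x" "x < t"
    show "(u has_real_derivative w - r x * sin (u x)) (at x)" using der x by blast
    assume ux: "p - d \<le> u x" "u x \<le> p"
    define v where "v = p - u x"
    have "sin (u x) = - sin (pi / 2 + v + of_nat k * (2 * pi))"
      unfolding sin_minus[symmetric] by (simp add: v_def p_def)
    also have "\<dots> = - cos v" using cos_2npi[of k] sin_2npi[of k] by (simp add: sin_add mult_ac)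
    finally have "sin (u x) = - cos v" .
    moreover have "cos d \<le> cos v"
      using ux d by (intro cos_monotone_0_pi_le) (auto simp: v_def)
    then have "r0 * cos d \<le> r x * cos v"
      using r[OF x(1)] w w1(1) d(3) by (intro mult_mono) auto
    ultimately show "0 \<le> w - r x * sin (u x)"
      using w d(3) by (simp add: field_simps)
  qed (use d p that in auto)
  then show ?thesis by blast
qed

text \<open>Where the cosine lies in [-c, c], its square leaves sin^2 \<ge> 1 - c^2, so the coupling
  outweighs the frequency and the cosine cannot decrease. Height is lost only inside one of the two
  caps above c or below -c, each of length 1 - c.\<close>

lemma winfree_cos_decrease_le:
  assumes sol: "ode_solution (winfree_field \<omega> \<kappa>) \<theta>" and st: "0 \<le> s" "s \<le> t"
    and \<kappa>: "0 < \<kappa>" and \<rho>: "0 < \<rho>" and R: "\<And>x. s < x \<Longrightarrow> x < t \<Longrightarrow> \<rho> \<le> winfree_R (\<theta> x)"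
    and c: "0 < c" "c \<le> 1" and \<omega>: "(\<omega> $ i)\<^sup>2 \<le> (\<kappa> * \<rho>)\<^sup>2 * (1 - c\<^sup>2)"
  shows "cos (\<theta> s $ i) - (1 - c) \<le> cos (\<theta> t $ i)"
proof (rule ccontr)
  assume neg: "\<not> ?thesis"
  define u where "u x = cos (\<theta> x $ i)" for x
  have lt: "u t < u s - (1 - c)" using neg by (simp add: u_def)
  have u1: "u s \<le> 1" "- 1 \<le> u t" by (auto simp: u_def)
  \<comment> \<open>The band is [-c, c] cut down to the range between \<open>u t\<close> and
    \<open>u s\<close>. A drop by more than \<open>1 - c\<close> forces \<open>u t < c\<close> and
    \<open>- c < u s\<close>, so the cut band is not degenerate, and the resulting inequality is
    absurd.\<close>
  have "max (u t) (- c) < u t"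
  proof (rule no_downcrossing[where s = s and t = t and b = "min (u s) c"])
    show "continuous_on {s..t} u"
      unfolding u_def by (intro continuous_intros ode_solution_continuous_on[OF sol st(1)])
    fix x assume x: "s < x" "x < t"
    let ?s = "sin (\<theta> x $ i)"
    show "(u has_real_derivative - ?s * winfree_field \<omega> \<kappa> (\<theta> x) $ i) (at x)"
      unfolding u_def using winfree_theta_has_derivative[OF sol, of x i] x st
      by (auto intro!: derivative_eq_intros)
    assume "max (u t) (- c) \<le> u x" "u x \<le> min (u s) c"
    then have "\<bar>u x\<bar> \<le> \<bar>c\<bar>" using c by auto
    then have "(u x)\<^sup>2 \<le> c\<^sup>2" by (simp add: abs_le_square_iff)
    then have "1 - c\<^sup>2 \<le> ?s\<^sup>2" by (simp add: u_def cos_squared_eq)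
    then have "(\<kappa> * \<rho>)\<^sup>2 * (1 - c\<^sup>2) \<le> (\<kappa> * \<rho>)\<^sup>2 * ?s\<^sup>2" by (intro mult_left_mono) auto
    then have "(\<omega> $ i)\<^sup>2 \<le> (\<kappa> * \<rho> * ?s)\<^sup>2" using \<omega> by (simp add: power_mult_distrib)
    then have "\<bar>\<omega> $ i\<bar> \<le> \<bar>\<kappa> * \<rho> * ?s\<bar>" by (simp add: abs_le_square_iff)
    also have "\<dots> = \<kappa> * \<rho> * \<bar>?s\<bar>" using \<kappa> \<rho> by (simp add: abs_mult)
    also have "\<dots> \<le> \<kappa> * winfree_R (\<theta> x) * \<bar>?s\<bar>"
      using R[OF x] \<kappa> by (intro mult_right_mono mult_left_mono) auto
    finally have "\<bar>\<omega> $ i\<bar> * \<bar>?s\<bar> \<le> \<kappa> * winfree_R (\<theta> x) * \<bar>?s\<bar> * \<bar>?s\<bar>"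
      by (intro mult_right_mono) auto
    moreover have "?s * \<omega> $ i \<le> \<bar>\<omega> $ i\<bar> * \<bar>?s\<bar>"
      by (metis abs_ge_self abs_mult mult.commute)
    ultimately have "?s * \<omega> $ i \<le> \<kappa> * winfree_R (\<theta> x) * (?s * ?s)"
      by (simp add: mult.assoc)
    then show "0 \<le> - ?s * winfree_field \<omega> \<kappa> (\<theta> x) $ i"
      by (simp add: winfree_field_nth algebra_simps)
  qed (use st c lt u1 in auto)
  then show False by simp
qed

text \<open>Until the first time at which R is at most \<open>\<rho>\<close>,
  \<open>winfree_cos_decrease_le\<close> applies to every oscillator. The average has then lost at
  most \<open>1 - c\<close>, too little to reach \<open>\<rho>\<close>.\<close>

lemma winfree_R_trapped:
  fixes \<theta> :: "real \<Rightarrow> real^'n"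
  assumes sol: "ode_solution (winfree_field \<omega> \<kappa>) \<theta>" and T: "0 \<le> T" "T \<le> t"
    and \<kappa>: "0 < \<kappa>" and \<rho>: "0 < \<rho>"
    and c: "0 < c" "c \<le> 1" and \<omega>: "\<And>i. (\<omega> $ i)\<^sup>2 \<le> (\<kappa> * \<rho>)\<^sup>2 * (1 - c\<^sup>2)"
    and R: "\<rho> + (1 - c) < winfree_R (\<theta> T)"
  shows "\<rho> < winfree_R (\<theta> t)"
proof (rule ccontr)
  assume neg: "\<not> ?thesis"
  define X where "X = {T..t} \<inter> (\<lambda>x. winfree_R (\<theta> x)) -` {..\<rho>}"
  have "continuous_on {T..t} (\<lambda>x. winfree_R (\<theta> x))"
    by (rule continuous_on_compose2[OF continuous_on_winfree_R[of UNIV] ode_solution_continuous_on[OF sol T(1)]]) auto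
  then have "closed X" unfolding X_def by (intro continuous_closed_preimage) auto
  moreover have "bounded X" unfolding X_def by (simp add: bounded_Int)
  ultimately have "compact X" by (simp add: compact_eq_bounded_closed)
  moreover have "X \<noteq> {}" using neg T by (auto simp: X_def)
  ultimately obtain p where p: "p \<in> X" "\<And>x. x \<in> X \<Longrightarrow> p \<le> x"
    using compact_attains_inf[of X] by metis
  have "\<rho> \<le> winfree_R (\<theta> x)" if "T < x" "x < p" for x
    using p(1) p(2)[of x] that by (force simp: X_def)
  then have "cos (\<theta> T $ i) - (1 - c) \<le> cos (\<theta> p $ i)" for i
    using p(1) T by (intro winfree_cos_decrease_le[OF sol _ _ \<kappa> \<rho> _ c \<omega>]) (auto simp: X_def)
  then have "(\<Sum>i\<in>UNIV. cos (\<theta> T $ i) - (1 - c)) \<le> (\<Sum>i\<in>UNIV. cos (\<theta> p $ i))"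
    by (intro sum_mono)
  then have "real CARD('n) * (winfree_R (\<theta> T) - (1 - c)) \<le> real CARD('n) * winfree_R (\<theta> p)"
    unfolding sum_subtractf sum_cos_eq_winfree_R by (simp add: algebra_simps)
  then have "winfree_R (\<theta> T) - (1 - c) \<le> winfree_R (\<theta> p)" by simp
  then show False using p(1) R by (auto simp: X_def)
qed

section \<open>Energy and convergence of trajectories\<close>

lemma winfree_energy_has_derivative:
  fixes \<theta> :: "real \<Rightarrow> real^'n"
  assumes sol: "ode_solution (winfree_field \<omega> \<kappa>) \<theta>" and "0 < t"
  shows "((\<lambda>t. (\<Sum>i\<in>UNIV. \<omega> $ i * \<theta> t $ i) + \<kappa> * real CARD('n) / 2 * (winfree_R (\<theta> t))\<^sup>2)
     has_real_derivative (\<Sum>i\<in>UNIV. (winfree_field \<omega> \<kappa> (\<theta> t) $ i)\<^sup>2)) (at t)"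
proof -
  let ?F = "winfree_field \<omega> \<kappa> (\<theta> t)" and ?N = "real CARD('n)"
  let ?S = "\<Sum>j\<in>UNIV. sin (\<theta> t $ j) * ?F $ j"
  have "((\<lambda>t. (\<Sum>i\<in>UNIV. \<omega> $ i * \<theta> t $ i) + \<kappa> * ?N / 2 * (winfree_R (\<theta> t))\<^sup>2)
     has_real_derivative ((\<Sum>i\<in>UNIV. \<omega> $ i * ?F $ i)
       + \<kappa> * ?N / 2 * (2 * winfree_R (\<theta> t) * (- (1 / ?N) * ?S)))) (at t)"
    using winfree_theta_has_derivative[OF assms] winfree_R_has_real_derivative[OF assms]
    by (auto intro!: derivative_eq_intros simp: mult.commute)
  moreover have "\<kappa> * ?N / 2 * (2 * winfree_R (\<theta> t) * (- (1 / ?N) * ?S)) = - \<kappa> * winfree_R (\<theta> t) * ?S"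
    by simp
  moreover have "(\<Sum>i\<in>UNIV. \<omega> $ i * ?F $ i) + - \<kappa> * winfree_R (\<theta> t) * ?S = (\<Sum>i\<in>UNIV. (?F $ i)\<^sup>2)"
    unfolding sum_distrib_left sum.distrib[symmetric]
    by (intro sum.cong) (auto simp: winfree_field_nth power2_eq_square algebra_simps)
  ultimately show ?thesis by (simp only:)
qed

lemma winfree_phase_bounded:
  assumes sol: "ode_solution (winfree_field \<omega> \<kappa>) \<theta>" and T: "0 \<le> T" and \<kappa>: "0 < \<kappa>"
    and R: "\<And>t. T \<le> t \<Longrightarrow> \<rho> \<le> winfree_R (\<theta> t)" and \<omega>: "\<bar>\<omega> $ i\<bar> < \<kappa> * \<rho>"
  obtains b where "\<And>t. T \<le> t \<Longrightarrow> \<bar>\<theta> t $ i\<bar> < b"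
proof -
  have cont: "continuous_on {T..} (\<lambda>t. \<theta> t $ i)"
    using sol T unfolding ode_solution_def
    by (intro continuous_intros continuous_on_subset[where s = "{0..}" and t = "{T..}"]) auto
  have der: "((\<lambda>t. \<theta> t $ i) has_real_derivative \<omega> $ i - \<kappa> * winfree_R (\<theta> t) * sin (\<theta> t $ i)) (at t)" if "T < t" for t
    using winfree_theta_has_derivative[OF sol, of t i] that T by (simp add: winfree_field_nth)
  have r: "\<kappa> * \<rho> \<le> \<kappa> * winfree_R (\<theta> t)" if "T < t" for t
    using R[of t] that \<kappa> by simp
  obtain a where a: "\<And>t. T \<le> t \<Longrightarrow> a < \<theta> t $ i"
    using phase_bounded_below[OF cont der r \<omega>] by blast
  \<comment> \<open>The equation keeps its form when phase and frequency both change sign, so the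
    lower bound also yields an upper bound.\<close>
  have der': "((\<lambda>t. - \<theta> t $ i) has_real_derivative - \<omega> $ i - \<kappa> * winfree_R (\<theta> t) * sin (- \<theta> t $ i)) (at t)"
    if "T < t" for t
    using DERIV_minus[OF der[OF that]] by (simp add: algebra_simps)
  have "\<bar>- \<omega> $ i\<bar> < \<kappa> * \<rho>" using \<omega> by simp
  then obtain b where b: "\<And>t. T \<le> t \<Longrightarrow> b < - \<theta> t $ i"
    using phase_bounded_below[OF continuous_on_minus[OF cont] der' r] by blast
  show thesis
  proof (rule that)
    fix t assume "T \<le> t"
    then show "\<bar>\<theta> t $ i\<bar> < \<bar>a\<bar> + \<bar>b\<bar> + 1" using a[of t] b[of t] by linarith
  qed
qed

text \<open>The energy is bounded because the phases are, its derivative is the sum of the squared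
  velocities, and each velocity is Lipschitz in time; this is the setting of
  \<open>barbalat_square\<close>.\<close>

lemma winfree_field_tendsto_0:
  fixes \<theta> :: "real \<Rightarrow> real^'n"
  assumes sol: "ode_solution (winfree_field \<omega> \<kappa>) \<theta>" and T: "0 \<le> T" and \<kappa>: "0 < \<kappa>"
    and R: "\<And>t. T \<le> t \<Longrightarrow> \<rho> \<le> winfree_R (\<theta> t)" and \<omega>: "\<And>i. \<bar>\<omega> $ i\<bar> < \<kappa> * \<rho>"
  shows "((\<lambda>t. winfree_field \<omega> \<kappa> (\<theta> t) $ i) \<longlongrightarrow> 0) at_top"
proof -
  have "\<exists>b. \<forall>t\<ge>T. \<bar>\<theta> t $ j\<bar> < b" for j
    using winfree_phase_bounded[OF sol T \<kappa> R \<omega>, of j] by metis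
  then obtain b where b: "\<And>j t. T \<le> t \<Longrightarrow> \<bar>\<theta> t $ j\<bar> < b j" by metis
  define L where "L = 3 * \<kappa> * real CARD('n)"
  define C where "C = (\<Sum>i\<in>UNIV. \<bar>\<omega> $ i\<bar>) + 2 * \<kappa> * real CARD('n)"
  show ?thesis
  \<comment> \<open>The start is moved to a positive time because solutions are only required to be
    differentiable for \<open>t > 0\<close>.\<close>
  proof (rule barbalat_square[where T = "max T 1" and K = "L * C"])
    fix s t :: real assume st: "max T 1 \<le> s" "s \<le> t"
    have "\<bar>(winfree_field \<omega> \<kappa> (\<theta> t) - winfree_field \<omega> \<kappa> (\<theta> s)) $ i\<bar>
        \<le> norm (winfree_field \<omega> \<kappa> (\<theta> t) - winfree_field \<omega> \<kappa> (\<theta> s))"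
      by (rule component_le_norm_cart)
    also have "\<dots> \<le> L * norm (\<theta> t - \<theta> s)"
      unfolding L_def using \<kappa> by (intro winfree_field_lipschitz) simp
    also have "\<dots> \<le> L * (C * (t - s))"
      unfolding C_def using \<kappa> st
      by (intro mult_left_mono ode_solution_lipschitz[OF sol] winfree_field_bounded) (auto simp: L_def)
    finally show "\<bar>winfree_field \<omega> \<kappa> (\<theta> t) $ i - winfree_field \<omega> \<kappa> (\<theta> s) $ i\<bar> \<le> L * C * (t - s)"
      by (simp add: mult.assoc)
  next
    fix t :: real assume t: "max T 1 \<le> t"
    show "((\<lambda>t. (\<Sum>i\<in>UNIV. \<omega> $ i * \<theta> t $ i) + \<kappa> * real CARD('n) / 2 * (winfree_R (\<theta> t))\<^sup>2)
       has_real_derivative (\<Sum>i\<in>UNIV. (winfree_field \<omega> \<kappa> (\<theta> t) $ i)\<^sup>2)) (at t)"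
      using t by (intro winfree_energy_has_derivative[OF sol]) auto
    show "(winfree_field \<omega> \<kappa> (\<theta> t) $ i)\<^sup>2 \<le> (\<Sum>i\<in>UNIV. (winfree_field \<omega> \<kappa> (\<theta> t) $ i)\<^sup>2)"
      by (intro member_le_sum) auto
    have "\<omega> $ j * \<theta> t $ j \<le> \<bar>\<omega> $ j\<bar> * b j" for j
    proof -
      have "\<omega> $ j * \<theta> t $ j \<le> \<bar>\<omega> $ j\<bar> * \<bar>\<theta> t $ j\<bar>" by (metis abs_ge_self abs_mult)
      also have "\<dots> \<le> \<bar>\<omega> $ j\<bar> * b j" using b[of t j] t by (intro mult_left_mono) auto
      finally show ?thesis .
    qed
    moreover have "(winfree_R (\<theta> t))\<^sup>2 \<le> 2\<^sup>2"
      using winfree_R_nonneg winfree_R_le_2 by (intro power_mono) auto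
    ultimately show "(\<Sum>i\<in>UNIV. \<omega> $ i * \<theta> t $ i) + \<kappa> * real CARD('n) / 2 * (winfree_R (\<theta> t))\<^sup>2
        \<le> (\<Sum>i\<in>UNIV. \<bar>\<omega> $ i\<bar> * b i) + \<kappa> * real CARD('n) / 2 * 2\<^sup>2"
      using \<kappa> by (intro add_mono sum_mono mult_left_mono) auto
  qed
qed

text \<open>The factor belonging to the current set of nonnegative cosines is controlled by the
  velocities, and the others are at most 2 in modulus. So the product tends to 0 along the
  trajectory even if that set keeps changing.\<close>

lemma winfree_R_convergent:
  fixes \<theta> :: "real \<Rightarrow> real^'n"
  assumes sol: "ode_solution (winfree_field \<omega> \<kappa>) \<theta>" and T: "0 \<le> T" and \<kappa>: "0 < \<kappa>" and \<rho>: "0 < \<rho>"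
    and R: "\<And>t. T \<le> t \<Longrightarrow> \<rho> \<le> winfree_R (\<theta> t)" and \<omega>: "\<And>i. \<bar>\<omega> $ i\<bar> < \<kappa> * \<rho>"
  shows "\<exists>Rinf. ((\<lambda>t. winfree_R (\<theta> t)) \<longlongrightarrow> Rinf) at_top"
proof -
  define G where "G r = (\<Prod>A\<in>UNIV. winfree_balance \<omega> \<kappa> A r)" for r
  define e where "e t = (1 / real CARD('n)) * (\<Sum>i\<in>UNIV. sqrt (2 * \<bar>winfree_field \<omega> \<kappa> (\<theta> t) $ i\<bar> / (\<kappa> * \<rho>)))" for t
  define M :: real where "M = 2 ^ (CARD('n set) - 1)"
  have \<omega>': "\<bar>\<omega> $ i\<bar> \<le> \<kappa> * \<rho>" for i using \<omega>[of i] by simp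
  have cont: "continuous_on {T..} (\<lambda>t. winfree_R (\<theta> t))"
    using sol T unfolding ode_solution_def
    by (intro continuous_on_compose2[OF continuous_on_winfree_R[of UNIV]]
        continuous_on_subset[where s = "{0..}" and t = "{T..}"]) auto
  have "((\<lambda>t. e t * M) \<longlongrightarrow> ((1 / real CARD('n)) * (\<Sum>i\<in>(UNIV :: 'n set). sqrt (2 * \<bar>0\<bar> / (\<kappa> * \<rho>)))) * M) at_top"
    unfolding e_def using \<kappa> \<rho> by (intro tendsto_intros winfree_field_tendsto_0[OF sol T \<kappa> R \<omega>]) auto
  then have lim: "((\<lambda>t. e t * M) \<longlongrightarrow> 0) at_top" by simp
  have "\<bar>G (winfree_R (\<theta> t))\<bar> \<le> e t * M" if t: "T \<le> t" for t
  proof -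
    let ?A = "{i. 0 \<le> cos (\<theta> t $ i)}"
    have "\<bar>G (winfree_R (\<theta> t))\<bar> = \<bar>winfree_balance \<omega> \<kappa> ?A (winfree_R (\<theta> t))\<bar> *
        (\<Prod>A\<in>UNIV - {?A}. \<bar>winfree_balance \<omega> \<kappa> A (winfree_R (\<theta> t))\<bar>)"
      unfolding G_def abs_prod by (rule prod.remove) auto
    also have "\<dots> \<le> e t * (\<Prod>A\<in>UNIV - {?A}. 2)"
      unfolding e_def
      using abs_winfree_balance_le[OF \<kappa> \<rho> R[OF t] \<omega>'] \<kappa> \<rho>
      by (intro mult_mono prod_mono prod_nonneg mult_nonneg_nonneg sum_nonneg) auto
    also have "(\<Prod>A\<in>UNIV - {?A}. 2 :: real) = M"
      by (simp add: M_def card_Diff_singleton)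
    finally show ?thesis .
  qed
  then have "\<forall>\<^sub>F t in at_top. norm (G (winfree_R (\<theta> t))) \<le> e t * M"
    by (auto simp: eventually_at_top_linorder)
  then have G: "((\<lambda>t. G (winfree_R (\<theta> t))) \<longlongrightarrow> 0) at_top"
    using lim by (rule Lim_null_comparison)
  have "\<rho> \<le> 2" using R[of T] winfree_R_le_2[of "\<theta> T"] by simp
  have bd: "\<forall>\<^sub>F t in at_top. \<rho> / 2 < winfree_R (\<theta> t) \<and> winfree_R (\<theta> t) < 3"
    using eventually_ge_at_top[of T]
  proof eventually_elim
    case (elim t)
    then show ?case using R[of t] \<rho> winfree_R_le_2[of "\<theta> t"] by linarith
  qed
  show ?thesis
  proof (rule convergent_if_eventually_one_sided[OF _ bd])
    fix x y :: real assume "x < y"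
    show "\<exists>r>x. r < y \<and> ((\<forall>\<^sub>F t in at_top. winfree_R (\<theta> t) < r) \<or> (\<forall>\<^sub>F t in at_top. r < winfree_R (\<theta> t)))"
    \<comment> \<open>Nonvanishing of the product is available only from \<open>\<rho>\<close>
      upwards; lower levels are exceeded from time \<open>T\<close> on.\<close>
    proof (cases "x < \<rho>")
      case True
      then obtain r where r: "x < r" "r < min y \<rho>" using dense[of x "min y \<rho>"] \<open>x < y\<close> by auto
      then have "\<forall>t\<ge>T. r < winfree_R (\<theta> t)" using R by force
      then have "\<forall>\<^sub>F t in at_top. r < winfree_R (\<theta> t)" by (auto simp: eventually_at_top_linorder)
      then show ?thesis using r by auto
    next
      case False
      then obtain r where r: "x < r" "r < y" "G r \<noteq> 0"
        unfolding G_def using prod_winfree_balance_not_0[OF \<kappa> _ _ \<omega>', of x y] \<rho> \<open>\<rho> \<le> 2\<close> \<open>x < y\<close> by auto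
      then show ?thesis using eventually_one_sided[OF cont G] by blast
    qed
  qed
qed

text \<open>Solving the field for the sine gives (\<omega> - velocity) / (\<kappa> R), which has a
  limit once R does. A bounded continuous phase then converges, as the sine is constant on no
  interval.\<close>

lemma winfree_phase_convergent:
  fixes \<theta> :: "real \<Rightarrow> real^'n"
  assumes sol: "ode_solution (winfree_field \<omega> \<kappa>) \<theta>" and T: "0 \<le> T" and \<kappa>: "0 < \<kappa>" and \<rho>: "0 < \<rho>"
    and R: "\<And>t. T \<le> t \<Longrightarrow> \<rho> \<le> winfree_R (\<theta> t)" and \<omega>: "\<And>i. \<bar>\<omega> $ i\<bar> < \<kappa> * \<rho>"
  shows "\<exists>L. ((\<lambda>t. \<theta> t $ i) \<longlongrightarrow> L) at_top"
proof -
  obtain Rinf where Rinf: "((\<lambda>t. winfree_R (\<theta> t)) \<longlongrightarrow> Rinf) at_top"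
    using winfree_R_convergent[OF sol T \<kappa> \<rho> R \<omega>] by blast
  have "\<forall>\<^sub>F t in at_top. \<rho> \<le> winfree_R (\<theta> t)" using R by (auto simp: eventually_at_top_linorder)
  then have "\<rho> \<le> Rinf" using Rinf by (intro tendsto_lowerbound[OF Rinf]) auto
  obtain b where b: "\<And>t. T \<le> t \<Longrightarrow> \<bar>\<theta> t $ i\<bar> < b"
    using winfree_phase_bounded[OF sol T \<kappa> R \<omega>] by blast
  have "((\<lambda>t. (\<omega> $ i - winfree_field \<omega> \<kappa> (\<theta> t) $ i) / (\<kappa> * winfree_R (\<theta> t))) \<longlongrightarrow> (\<omega> $ i - 0) / (\<kappa> * Rinf)) at_top"
    using \<kappa> \<rho> \<open>\<rho> \<le> Rinf\<close> by (intro tendsto_intros Rinf winfree_field_tendsto_0[OF sol T \<kappa> R \<omega>]) auto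
  moreover have "\<forall>\<^sub>F t in at_top. (\<omega> $ i - winfree_field \<omega> \<kappa> (\<theta> t) $ i) / (\<kappa> * winfree_R (\<theta> t)) = sin (\<theta> t $ i)"
    using eventually_ge_at_top[of T]
  proof eventually_elim
    case (elim t)
    then have "0 < winfree_R (\<theta> t)" using R[of t] \<rho> by linarith
    then show ?case using \<kappa> by (simp add: winfree_field_nth)
  qed
  ultimately have "((\<lambda>t. sin (\<theta> t $ i)) \<longlongrightarrow> (\<omega> $ i - 0) / (\<kappa> * Rinf)) at_top"
    by (rule Lim_transform_eventually)
  moreover have "continuous_on {T..} (\<lambda>t. \<theta> t $ i)"
    using sol T unfolding ode_solution_def
    by (intro continuous_intros continuous_on_subset[where s = "{0..}" and t = "{T..}"]) auto
  moreover have "\<forall>\<^sub>F t in at_top. - b < \<theta> t $ i \<and> \<theta> t $ i < b"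
    using eventually_ge_at_top[of T]
  proof eventually_elim
    case (elim t)
    then show ?case using b[of t] by linarith
  qed
  ultimately show ?thesis using sin_tendsto_imp_convergent by blast
qed

theorem theorem1p1:
  fixes \<omega> :: "real ^ 'n" and \<kappa> :: real
  assumes "\<kappa> > 0"
    and "\<kappa> > 2 * Max (range (\<lambda>i. \<bar>\<omega> $ i\<bar>))"
  shows "AE \<theta>0 in lebesgue. \<forall>\<theta>. winfree_solution \<omega> \<kappa> \<theta>0 \<theta> \<longrightarrow>
           ((\<forall>i. (\<exists>L. ((\<lambda>t. \<theta> t $ i) \<longlongrightarrow> L) at_top)
                 \<and> ((\<lambda>t. vector_derivative \<theta> (at t) $ i) \<longlongrightarrow> 0) at_top)
         \<and> (\<exists>Rinf. ((\<lambda>t. winfree_R (\<theta> t)) \<longlongrightarrow> Rinf) at_top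
               \<and> Rinf \<ge> sqrt (1/2 + sqrt (1/4 - (Max (range (\<lambda>i. \<bar>\<omega> $ i\<bar>)))\<^sup>2 / \<kappa>\<^sup>2))))"
proof -
  define m where "m = Max (range (\<lambda>i. \<bar>\<omega> $ i\<bar>))"
  define b where "b = sqrt (1/4 - m\<^sup>2 / \<kappa>\<^sup>2)"
  \<comment> \<open>\<open>\<rho>0\<^sup>2\<close> is the larger root of x (1 - x) = m^2 /
    \<kappa>^2, so \<open>\<rho>\<^sup>2 * (1 - \<rho>\<^sup>2)\<close> exceeds
    \<open>m\<^sup>2 / \<kappa>\<^sup>2\<close> for \<open>\<rho>\<close> between
    \<open>sqrt (1/2)\<close> and \<open>\<rho>0\<close>.\<close>
  define \<rho>0 where "\<rho>0 = sqrt (1/2 + b)"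
  have \<kappa>: "0 < \<kappa>" by fact
  have m: "\<bar>\<omega> $ i\<bar> \<le> m" for i unfolding m_def by (intro Max_ge) auto
  have m0: "0 \<le> m" using m[of undefined] by linarith
  have "2 * m < \<kappa>" using assms(2) by (simp add: m_def)
  then have "(2 * m)\<^sup>2 < \<kappa>\<^sup>2" using m0 by (intro power_strict_mono) auto
  then have b0: "0 < b" using \<kappa> by (simp add: b_def power_mult_distrib field_simps)
  then have b2: "b\<^sup>2 = 1/4 - m\<^sup>2 / \<kappa>\<^sup>2" unfolding b_def by simp
  have \<rho>0: "\<rho>0\<^sup>2 = 1/2 + b" "sqrt (1/2) < \<rho>0" using b0 by (auto simp: \<rho>0_def)
  have trap: "\<exists>T\<ge>0. \<forall>t\<ge>T. \<rho> \<le> winfree_R (\<theta> t)" and \<rho>_pos: "0 < \<rho>" and \<rho>_\<omega>: "\<And>i. \<bar>\<omega> $ i\<bar> < \<kappa> * \<rho>"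
    if \<rho>: "sqrt (1/2) < \<rho>" "\<rho> < \<rho>0" and sol: "ode_solution (winfree_field \<omega> \<kappa>) \<theta>"
      and R: "\<And>k::nat. \<exists>t\<ge>0. 1 - 1 / real (Suc k) < winfree_R (\<theta> t)" for \<rho> and \<theta> :: "real \<Rightarrow> real^'n"
  proof -
    show pos: "0 < \<rho>" using \<rho>(1) by (rule order.strict_trans[rotated]) simp
    have "(sqrt (1/2))\<^sup>2 < \<rho>\<^sup>2" using \<rho> by (intro power_strict_mono) auto
    then have l: "1/2 < \<rho>\<^sup>2" by simp
    have "\<rho>\<^sup>2 < \<rho>0\<^sup>2" using \<rho> pos by (intro power_strict_mono) auto
    then have "\<rho>\<^sup>2 - 1/2 < b" using \<rho>0 by simp
    then have "(\<rho>\<^sup>2 - 1/2)\<^sup>2 < b\<^sup>2" using l by (intro power_strict_mono) auto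
    moreover have "(\<rho>\<^sup>2 - 1/2)\<^sup>2 = 1/4 - \<rho>\<^sup>2 * (1 - \<rho>\<^sup>2)"
      by (simp add: power2_eq_square field_simps)
    ultimately have key: "m\<^sup>2 / \<kappa>\<^sup>2 < \<rho>\<^sup>2 * (1 - \<rho>\<^sup>2)"
      unfolding b2 by linarith
    \<comment> \<open>This \<open>c\<close> gives
      \<open>(\<kappa> * \<rho>)\<^sup>2 * (1 - c\<^sup>2) = m\<^sup>2\<close>, the frequency
      condition for trapping with equality at the largest frequency; \<open>key\<close> then amounts
      to \<open>\<rho> < c\<close>.\<close>
    define c where "c = sqrt (1 - m\<^sup>2 / (\<kappa> * \<rho>)\<^sup>2)"
    have key2: "m\<^sup>2 / (\<kappa> * \<rho>)\<^sup>2 < 1 - \<rho>\<^sup>2"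
      using key pos \<kappa> by (simp add: power_mult_distrib field_simps)
    then have c2: "c\<^sup>2 = 1 - m\<^sup>2 / (\<kappa> * \<rho>)\<^sup>2" unfolding c_def
      using zero_le_power2[of \<rho>] by (intro real_sqrt_pow2) linarith
    have "\<rho> < c" unfolding c_def using key2 pos by (intro real_less_rsqrt) linarith
    have c1: "c \<le> 1" unfolding c_def by (intro real_le_lsqrt) auto
    have kr: "0 < \<kappa> * \<rho>" using \<kappa> pos by simp
    have \<omega>c: "(\<omega> $ i)\<^sup>2 \<le> (\<kappa> * \<rho>)\<^sup>2 * (1 - c\<^sup>2)" for i
    proof -
      have "(\<omega> $ i)\<^sup>2 \<le> m\<^sup>2" using m[of i] m0 by (simp add: abs_le_square_iff[symmetric])
      also have "\<dots> = (\<kappa> * \<rho>)\<^sup>2 * (1 - c\<^sup>2)" using \<kappa> pos by (simp add: c2)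
      finally show ?thesis .
    qed
    show "\<bar>\<omega> $ i\<bar> < \<kappa> * \<rho>" for i
    proof -
      have "(\<kappa> * \<rho>)\<^sup>2 * (1 - c\<^sup>2) < (\<kappa> * \<rho>)\<^sup>2 * 1"
        using kr \<open>\<rho> < c\<close> pos by (intro mult_strict_left_mono) auto
      then have "(\<omega> $ i)\<^sup>2 < (\<kappa> * \<rho>)\<^sup>2" using \<omega>c[of i] by linarith
      then show ?thesis
        using kr by (intro power_less_imp_less_base[of "\<bar>\<omega> $ i\<bar>" 2 "\<kappa> * \<rho>"]) auto
    qed
    \<comment> \<open>The entry level \<open>\<rho> + (1 - c)\<close> lies below 1 by
      \<open>c - \<rho>\<close>, a gap that closes as \<open>\<rho>\<close> approaches
      \<open>\<rho>0\<close>. Hence R has to exceed every \<open>1 - 1 / real (Suc k)\<close> at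
      some time.\<close>
    obtain k :: nat where k: "1 / real (Suc k) < c - \<rho>"
      using nat_approx_posE[of "c - \<rho>"] \<open>\<rho> < c\<close> by auto
    obtain T where T: "0 \<le> T" "1 - 1 / real (Suc k) < winfree_R (\<theta> T)" using R by blast
    then have "\<rho> + (1 - c) < winfree_R (\<theta> T)" using k by linarith
    then have "\<rho> < winfree_R (\<theta> t)" if "T \<le> t" for t
      using \<open>\<rho> < c\<close> pos by (intro winfree_R_trapped[OF sol T(1) that \<kappa> pos _ c1 \<omega>c]) auto
    then show "\<exists>T\<ge>0. \<forall>t\<ge>T. \<rho> \<le> winfree_R (\<theta> t)" using T(1) by (meson less_imp_le)
  qed
  define E where "E k = {\<theta> 0 |\<theta>. ode_solution (winfree_field \<omega> \<kappa>) \<theta> \<and>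
      (\<forall>t\<ge>0. winfree_R (\<theta> t) \<le> 1 - 1 / real (Suc k))}" for k
  have "negligible (\<Union>k. E k)"
    unfolding E_def by (intro negligible_Union_nat negligible_winfree_low_R \<kappa>) auto
  then have "AE \<theta>0 in lebesgue. \<theta>0 \<notin> (\<Union>k. E k)"
    by (intro AE_not_in) (simp add: negligible_iff_null_sets)
  then show ?thesis
  proof (rule AE_mp, intro AE_I2 impI allI)
    fix \<theta>0 \<theta>
    assume notE: "\<theta>0 \<notin> (\<Union>k. E k)" and "winfree_solution \<omega> \<kappa> \<theta>0 \<theta>"
    then have sol: "ode_solution (winfree_field \<omega> \<kappa>) \<theta>" and "\<theta>0 = \<theta> 0"
      by (auto simp: winfree_solution_iff)
    have R: "\<exists>t\<ge>0. 1 - 1 / real (Suc k) < winfree_R (\<theta> t)" for k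
    proof (rule ccontr)
      assume "\<not> ?thesis"
      then have "\<theta>0 \<in> E k" unfolding E_def using sol \<open>\<theta>0 = \<theta> 0\<close> by force
      then show False using notE by blast
    qed
    obtain \<rho> where \<rho>: "sqrt (1/2) < \<rho>" "\<rho> < \<rho>0" using dense \<rho>0(2) by blast
    note pos = \<rho>_pos[OF \<rho> sol R] and \<omega>\<rho> = \<rho>_\<omega>[OF \<rho> sol R]
    obtain T where T: "0 \<le> T" "\<And>t. T \<le> t \<Longrightarrow> \<rho> \<le> winfree_R (\<theta> t)"
      using trap[OF \<rho> sol R] by blast
    obtain Rinf where Rinf: "((\<lambda>t. winfree_R (\<theta> t)) \<longlongrightarrow> Rinf) at_top"
      using winfree_R_convergent[OF sol T(1) \<kappa> pos T(2) \<omega>\<rho>] by blast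
    \<comment> \<open>Trapping is applied anew at each level \<open>r\<close> below
      \<open>\<rho>0\<close>, with its own entry time, and the limit inherits all these lower
      bounds.\<close>
    have "\<rho>0 \<le> Rinf"
    proof (rule dense_le_bounded[OF \<rho>0(2)])
      fix r assume r: "sqrt (1/2) < r" "r < \<rho>0"
      obtain T where "\<forall>t\<ge>T. r \<le> winfree_R (\<theta> t)" using trap[OF r sol R] by blast
      then have "\<forall>\<^sub>F t in at_top. r \<le> winfree_R (\<theta> t)" by (auto simp: eventually_at_top_linorder)
      then show "r \<le> Rinf" by (intro tendsto_lowerbound[OF Rinf]) auto
    qed
    moreover have "((\<lambda>t. vector_derivative \<theta> (at t) $ i) \<longlongrightarrow> 0) at_top" for i
    proof (rule Lim_transform_eventually[OF winfree_field_tendsto_0[OF sol T(1) \<kappa> T(2) \<omega>\<rho>]])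
      show "\<forall>\<^sub>F t in at_top. winfree_field \<omega> \<kappa> (\<theta> t) $ i = vector_derivative \<theta> (at t) $ i"
        using eventually_gt_at_top[of 0]
      proof eventually_elim
        case (elim t)
        then have "(\<theta> has_vector_derivative winfree_field \<omega> \<kappa> (\<theta> t)) (at t)"
          using sol by (simp add: ode_solution_def)
        then show ?case by (simp add: vector_derivative_at)
      qed
    qed
    ultimately show "(\<forall>i. (\<exists>L. ((\<lambda>t. \<theta> t $ i) \<longlongrightarrow> L) at_top)
                 \<and> ((\<lambda>t. vector_derivative \<theta> (at t) $ i) \<longlongrightarrow> 0) at_top)
         \<and> (\<exists>Rinf. ((\<lambda>t. winfree_R (\<theta> t)) \<longlongrightarrow> Rinf) at_top
               \<and> Rinf \<ge> sqrt (1/2 + sqrt (1/4 - (Max (range (\<lambda>i. \<bar>\<omega> $ i\<bar>)))\<^sup>2 / \<kappa>\<^sup>2)))"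
      using Rinf winfree_phase_convergent[OF sol T(1) \<kappa> pos T(2) \<omega>\<rho>]
      unfolding \<rho>0_def b_def m_def by blast
  qed
qed

end
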